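(* There exists an algorithm that takes as input a sequence $\tau=(\tau(1),\ldots,\tau(n))$ of natural numbers of length $n$ having $k$ distinct values and returns a longest heapable subsequence of $\tau$ in time $(k+1)!\cdot k\cdot O(n)$. Equivalently, the algorithm returns a maximum-sized binary tree in $\mathsf{PermDAG}(\tau)$.
   Context: A rooted tree whose nodes are labeled with values has the heap property if the value of every node is at least that of its parent. A sequence of natural numbers is heapable if its elements can be placed one at a time, in the order of the sequence, each new element being attached as a new leaf, so that at every step the result is a binary tree (every node has at most two children) with the heap property. A longest heapable subsequence of $\tau$ is a heapable subsequence of $\tau$ of maximum length. For a sequence $\sigma=(\sigma(1),\ldots,\sigma(n))$, the permutation DAG $\mathsf{PermDAG}(\sigma)$ has vertex set $\{t_1,\ldots,t_n\}$ and an arc $(t_j,t_i)$ for every $i,j\in[n]$ with $i<j$ and $\sigma(i)\le\sigma(j)$. In a directed graph $G$, a subgraph $T$ is an $r$-rooted binary tree if $r$ is the unique vertex of $T$ with no outgoing arcs in $T$, every vertex of $T$ has a unique directed path to $r$ in $T$, and every vertex of $T$ has in-degree at most $2$ in $T$; its size is its number of vertices. *)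

theory Defs
  imports
    "HOL-Library.Landau_Symbols"
    "HOL-Library.Sublist"
    "HOL-Library.Tree"
    "Graph_Theory.Graph_Theory"
begin

text \<open>
  Sequences \<open>(\<tau>(1), \<dots>, \<tau>(n))\<close> are lists, so \<open>\<tau>(i)\<close> is \<open>\<tau> ! (i - 1)\<close>.
\<close>

subsection \<open>Heapable sequences\<close>

text \<open>
  In \<^typ>\<open>'a tree\<close> the constructor \<^const>\<open>Leaf\<close> is an empty position; attaching a new leaf
  to a tree means filling one empty position with a childless node.
\<close>

inductive attach :: "'a \<Rightarrow> 'a tree \<Rightarrow> 'a tree \<Rightarrow> bool" where
  here: "attach x Leaf (Node Leaf x Leaf)"
| left: "attach x l l' \<Longrightarrow> attach x (Node l a r) (Node l' a r)"
| right: "attach x r r' \<Longrightarrow> attach x (Node l a r) (Node l a r')"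

inductive builds :: "nat list \<Rightarrow> nat tree \<Rightarrow> bool" where
  empty: "builds [] Leaf"
| step: "builds xs t \<Longrightarrow> attach x t t' \<Longrightarrow> heap t' \<Longrightarrow> builds (xs @ [x]) t'"

definition heapable :: "nat list \<Rightarrow> bool" where
  "heapable xs \<longleftrightarrow> (\<exists>t. builds xs t)"

definition longest_heapable_subseq :: "nat list \<Rightarrow> nat list \<Rightarrow> bool" where
  "longest_heapable_subseq xs \<tau> \<longleftrightarrow>
     subseq xs \<tau> \<and> heapable xs \<and>
     (\<forall>ys. subseq ys \<tau> \<and> heapable ys \<longrightarrow> length ys \<le> length xs)"

subsection \<open>Binary trees in directed graphs\<close>

text \<open>The vertex \<open>t\<^sub>i\<close> is represented by its index \<open>i\<close>.\<close>

definition PermDAG :: "nat list \<Rightarrow> (nat, nat \<times> nat) pre_digraph" where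
  "PermDAG \<sigma> =
     \<lparr> verts = {1..length \<sigma>},
       arcs = {(j, i). i \<in> {1..length \<sigma>} \<and> j \<in> {1..length \<sigma>} \<and> i < j \<and> \<sigma> ! (i - 1) \<le> \<sigma> ! (j - 1)},
       tail = fst, head = snd \<rparr>"

definition rooted_binary_tree :: "('a, 'b) pre_digraph \<Rightarrow> 'a \<Rightarrow> ('a, 'b) pre_digraph \<Rightarrow> bool" where
  "rooted_binary_tree G r T \<longleftrightarrow>
     subgraph T G \<and>
     (\<forall>v. v \<in> verts T \<and> out_arcs T v = {} \<longleftrightarrow> v = r) \<and>
     (\<forall>v \<in> verts T. \<exists>!p. pre_digraph.apath T v p r) \<and>
     (\<forall>v \<in> verts T. finite (in_arcs T v) \<and> in_degree T v \<le> 2)"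

definition maximum_binary_tree :: "('a, 'b) pre_digraph \<Rightarrow> ('a, 'b) pre_digraph \<Rightarrow> bool" where
  "maximum_binary_tree G T \<longleftrightarrow>
     (\<exists>r. rooted_binary_tree G r T) \<and>
     (\<forall>r' T'. rooted_binary_tree G r' T' \<longrightarrow> card (verts T') \<le> card (verts T))"

text \<open>
  The digraph given by a list of vertices and the list of their parents, where the parent
  entry \<open>0\<close> (not an index of any vertex) means that there is no parent.
\<close>

definition parent_graph :: "nat list \<Rightarrow> nat list \<Rightarrow> (nat, nat \<times> nat) pre_digraph" where
  "parent_graph vs ps =
     \<lparr> verts = set vs, arcs = {(v, p). (v, p) \<in> set (zip vs ps) \<and> p \<noteq> 0}, tail = fst, head = snd \<rparr>"

subsection \<open>Algorithms and their running time\<close>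

text \<open>
  Algorithms are programs for a unit-cost random access machine with structured control flow.
  The machine has registers and zero-initialised unbounded arrays (a program mentions only
  finitely many of either), all holding natural numbers. Its arithmetic is addition and
  truncated subtraction only: multiplication at unit cost would be unrealistically powerful on
  unbounded numbers. The time is the number of elementary operations, every constant, register
  access, array access, arithmetic operation, assignment and test costing one unit.
\<close>

datatype aexp =
    Const nat
  | Reg nat
  | Arr nat aexp
  | Add aexp aexp
  | Sub aexp aexp

datatype com =
    Skip
  | SetReg nat aexp
  | SetArr nat aexp aexp
  | Seq com com
  | IfLess aexp aexp com com
  | WhileLess aexp aexp com

type_synonym state = "(nat \<Rightarrow> nat) \<times> (nat \<Rightarrow> nat \<Rightarrow> nat)"

fun aval :: "aexp \<Rightarrow> state \<Rightarrow> nat" where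
  "aval (Const n) s = n"
| "aval (Reg x) s = fst s x"
| "aval (Arr a e) s = snd s a (aval e s)"
| "aval (Add e f) s = aval e s + aval f s"
| "aval (Sub e f) s = aval e s - aval f s"

fun acost :: "aexp \<Rightarrow> nat" where
  "acost (Const n) = 1"
| "acost (Reg x) = 1"
| "acost (Arr a e) = 1 + acost e"
| "acost (Add e f) = 1 + acost e + acost f"
| "acost (Sub e f) = 1 + acost e + acost f"

text \<open>\<open>exec c s t s'\<close>: started in state \<open>s\<close>, the program \<open>c\<close> halts in state \<open>s'\<close> after time \<open>t\<close>.\<close>

inductive exec :: "com \<Rightarrow> state \<Rightarrow> nat \<Rightarrow> state \<Rightarrow> bool" where
  Skip: "exec Skip s 1 s"
| SetReg: "exec (SetReg x e) s (1 + acost e) ((fst s)(x := aval e s), snd s)"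
| SetArr: "exec (SetArr a i e) s (1 + acost i + acost e)
     (fst s, (snd s)(a := (snd s a)(aval i s := aval e s)))"
| Seq: "exec c\<^sub>1 s\<^sub>1 t\<^sub>1 s\<^sub>2 \<Longrightarrow> exec c\<^sub>2 s\<^sub>2 t\<^sub>2 s\<^sub>3 \<Longrightarrow> exec (Seq c\<^sub>1 c\<^sub>2) s\<^sub>1 (t\<^sub>1 + t\<^sub>2) s\<^sub>3"
| IfTrue: "aval e s < aval f s \<Longrightarrow> exec c\<^sub>1 s t s' \<Longrightarrow>
     exec (IfLess e f c\<^sub>1 c\<^sub>2) s (1 + acost e + acost f + t) s'"
| IfFalse: "\<not> aval e s < aval f s \<Longrightarrow> exec c\<^sub>2 s t s' \<Longrightarrow>
     exec (IfLess e f c\<^sub>1 c\<^sub>2) s (1 + acost e + acost f + t) s'"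
| WhileFalse: "\<not> aval e s < aval f s \<Longrightarrow>
     exec (WhileLess e f c) s (1 + acost e + acost f) s"
| WhileTrue: "aval e s\<^sub>1 < aval f s\<^sub>1 \<Longrightarrow> exec c s\<^sub>1 t\<^sub>1 s\<^sub>2 \<Longrightarrow> exec (WhileLess e f c) s\<^sub>2 t\<^sub>2 s\<^sub>3 \<Longrightarrow>
     exec (WhileLess e f c) s\<^sub>1 (1 + acost e + acost f + t\<^sub>1 + t\<^sub>2) s\<^sub>3"

inductive_cases exec_elims:
  "exec Skip s t s'" "exec (SetReg x e) s t s'" "exec (SetArr a i e) s t s'"
  "exec (Seq c\<^sub>1 c\<^sub>2) s t s'" "exec (IfLess e f c\<^sub>1 c\<^sub>2) s t s'" "exec (WhileLess e f c) s t s'"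

lemma exec_deterministic:
  "exec c s t s' \<Longrightarrow> exec c s u s'' \<Longrightarrow> u = t \<and> s'' = s'"
proof (induction arbitrary: u s'' rule: exec.induct)
  case (Skip s)
  then show ?case by (auto elim: exec_elims(1))
next
  case (SetReg x e s)
  then show ?case by (auto elim: exec_elims(2))
next
  case (SetArr a i e s)
  then show ?case by (auto elim: exec_elims(3))
next
  case (Seq c\<^sub>1 s\<^sub>1 t\<^sub>1 s\<^sub>2 c\<^sub>2 t\<^sub>2 s\<^sub>3)
  from Seq.prems show ?case by (rule exec_elims(4)) (use Seq.IH in metis)
next
  case (IfTrue e s f c\<^sub>1 t s' c\<^sub>2)
  from IfTrue.prems show ?case by (rule exec_elims(5)) (use IfTrue.IH IfTrue.hyps in fastforce)+
next
  case (IfFalse e s f c\<^sub>2 t s' c\<^sub>1)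
  from IfFalse.prems show ?case by (rule exec_elims(5)) (use IfFalse.IH IfFalse.hyps in fastforce)+
next
  case (WhileFalse e s f c)
  from WhileFalse.prems show ?case by (rule exec_elims(6)) (use WhileFalse.hyps in fastforce)+
next
  case (WhileTrue e s\<^sub>1 f c t\<^sub>1 s\<^sub>2 t\<^sub>2 s\<^sub>3)
  from WhileTrue.prems show ?case by (rule exec_elims(6)) (use WhileTrue.IH WhileTrue.hyps in fastforce)+
qed

text \<open>
  The length of the input is in register \<open>0\<close> and its elements are in array \<open>0\<close>. The output
  consists of lists stored in several arrays, whose common length is in register \<open>0\<close>.
\<close>

definition input_state :: "nat list \<Rightarrow> state" where
  "input_state \<tau> =
     ((\<lambda>_. 0)(0 := length \<tau>),
      (\<lambda>_ _. 0)(0 := (\<lambda>i. if i < length \<tau> then \<tau> ! i else 0)))"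

definition output_list :: "nat \<Rightarrow> state \<Rightarrow> nat list" where
  "output_list a s = map (snd s a) [0..<fst s 0]"

end

theory Submission
  imports Defs "HOL-Library.Multiset"
begin

text \<open>
  Replace the values by their ranks \<open>1, \<dots>, k\<close>. All that matters about a partially built tree is, for
  every rank \<open>m\<close>, the number of free child positions below nodes of rank at most \<open>m\<close>; it never hurts
  to attach a new element to a node of the greatest possible rank. Truncating the count for \<open>m\<close> at
  \<open>m\<close> loses no information, so there are only \<open>2 \<cdot> 3 \<cdots> (k + 1) = (k + 1)!\<close> states, each with a
  transition computed in time \<open>O(k)\<close>. Dynamic programming over the suffixes of the sequence yields the
  optimal value for every state, and a forward pass recovers the elements. Both heapable subsequences
  and binary trees in the permutation DAG correspond to attaching elements one by one to free
  positions, so the same optimum solves both problems. The program enumerates the states with an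
  odometer in the factorial number system and keeps the free positions of the forward pass in one
  linked list per rank, which gives the parents.
\<close>

section \<open>Attaching elements to free positions\<close>

text \<open>That the greatest possible position is always best is proved by domination rather than
  by exchanging subtrees. If a state bounds the truncated counts of an arbitrary partial attachment
  from above, it still does so after \<open>upd\<close> accompanies any legal attachment. Hence
  \<open>best\<close> bounds every heapable subsequence and every tree in the DAG. The greedy choice
  matters only for attaining the bound, where it keeps the state equal to the truncated counts.

  The machine shapes the programs. Without multiplication, the code of a successor state is found by
  adding and subtracting stored factorials, factorials come from repeated addition, and table rows
  are addressed through a running offset; without division, each position stores its vertex. Work
  outside the table is of order \<open>n * k + k * k\<close>, which the bound absorbs since
  \<open>1 \<le> k \<le> n\<close> for nonempty input. For the empty sequence \<open>k = 0\<close>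
  makes the bound zero and there is no rooted tree, so the claims on time and trees concern nonempty
  input.\<close>

inductive fits :: "nat multiset \<Rightarrow> nat list \<Rightarrow> nat multiset \<Rightarrow> bool" where
  Nil: "fits M [] M"
| Cons: "v \<in># M \<Longrightarrow> v \<le> x \<Longrightarrow> fits (M - {#v#} + {#x, x#}) xs M' \<Longrightarrow> fits M (x # xs) M'"

text \<open>\<open>fits\<close> consumes a sequence from the front, as the recursion of
  \<open>best\<close> does, whereas trees grow at the back; this lemma reconciles the two.\<close>

lemma fits_snoc:
  "fits M xs M' \<Longrightarrow> v \<in># M' \<Longrightarrow> v \<le> x \<Longrightarrow> fits M (xs @ [x]) (M' - {#v#} + {#x, x#})"
proof (induction rule: fits.induct)
  case (Nil M)
  then show ?case using fits.Cons[of v M x "[]"] fits.Nil by auto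
next
  case (Cons w M y ys M')
  then show ?case by (auto intro: fits.Cons[of w])
qed

lemma fits_map:
  assumes "fits M xs M'" "mono f"
  shows "fits (image_mset f M) (map f xs) (image_mset f M')"
  using assms(1)
proof (induction rule: fits.induct)
  case (Cons v M x xs M')
  have "image_mset f (M - {#v#} + {#x, x#}) = image_mset f M - {#f v#} + {#f x, f x#}"
    using Cons.hyps(1) by (simp add: image_mset_Diff)
  then show ?case
    using Cons monoD[OF assms(2), of v x] by (auto intro!: fits.Cons[of "f v"])
qed (simp add: fits.Nil)

section \<open>Free positions of heap-ordered trees\<close>

primrec free_slots :: "nat \<Rightarrow> nat tree \<Rightarrow> nat multiset" where
  "free_slots v Leaf = {#v#}"
| "free_slots v (Node l a r) = free_slots a l + free_slots a r"

text \<open>The label \<open>u\<close> stands for the node above the tree. It has to vary in the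
  induction, because on descending into a subtree the node just left takes over this role.\<close>

lemma heap_attach:
  assumes "attach x t t'" "heap t'" "\<forall>y \<in> set_tree t'. u \<le> y"
  shows "heap t \<and> set_tree t' = insert x (set_tree t) \<and>
    (\<exists>v \<in># free_slots u t. v \<le> x \<and> free_slots u t' = free_slots u t - {#v#} + {#x, x#})"
  using assms
proof (induction arbitrary: u rule: attach.induct)
  case (left x l l' a r)
  have "heap l'" "\<forall>y \<in> set_tree l'. a \<le> y" using left.prems by auto
  from left.IH[OF this] obtain v where v: "v \<in># free_slots a l" "v \<le> x"
    "free_slots a l' = free_slots a l - {#v#} + {#x, x#}" "heap l" "set_tree l' = insert x (set_tree l)"
    by blast
  then have "v \<in># free_slots u (Node l a r)" by simp
  moreover have "free_slots u (Node l' a r) = free_slots u (Node l a r) - {#v#} + {#x, x#}"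
    using v(1,3) by simp
  ultimately show ?case using left.prems v by auto
next
  case (right x r r' l a)
  have "heap r'" "\<forall>y \<in> set_tree r'. a \<le> y" using right.prems by auto
  from right.IH[OF this] obtain v where v: "v \<in># free_slots a r" "v \<le> x"
    "free_slots a r' = free_slots a r - {#v#} + {#x, x#}" "heap r" "set_tree r' = insert x (set_tree r)"
    by blast
  then have "v \<in># free_slots u (Node l a r)" by simp
  moreover have "free_slots u (Node l a r') = free_slots u (Node l a r) - {#v#} + {#x, x#}"
    using v(1,3) by simp
  ultimately show ?case using right.prems v by auto
qed auto

lemma attach_free_slot:
  assumes "heap t" "v \<in># free_slots u t" "v \<le> x" "\<forall>y \<in> set_tree t. u \<le> y" "u \<le> x"
  shows "\<exists>t'. attach x t t' \<and> heap t' \<and> set_tree t' = insert x (set_tree t) \<and>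
    free_slots u t' = free_slots u t - {#v#} + {#x, x#}"
  using assms
proof (induction t arbitrary: u)
  case Leaf
  then show ?case by (auto intro!: exI[of _ "Node Leaf x Leaf"] attach.intros)
next
  case (Node l a r)
  \<comment> \<open>Positions below a node carry labels at least that of the node. Hence
    \<open>v \<le> x\<close> forces \<open>a \<le> x\<close>, which is the heap condition for
    placing \<open>x\<close> in the subtree.\<close>
  have ge: "w \<in># free_slots c t \<Longrightarrow> heap t \<Longrightarrow> \<forall>y \<in> set_tree t. c \<le> y \<Longrightarrow> c \<le> w" for w c t
    by (induction t arbitrary: c) force+
  from Node.prems(2) consider "v \<in># free_slots a l" | "v \<in># free_slots a r" by auto
  then show ?case
  proof cases
    case 1
    with ge[of v a l] Node.prems have "a \<le> x" by auto
    with Node.IH(1)[of a] 1 Node.prems obtain t' where t': "attach x l t'" "heap t'"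
      "set_tree t' = insert x (set_tree l)" "free_slots a t' = free_slots a l - {#v#} + {#x, x#}" by auto
    have "attach x (Node l a r) (Node t' a r)" using t'(1) by (rule attach.left)
    moreover have "heap (Node t' a r)" using Node.prems(1) t'(2,3) \<open>a \<le> x\<close> by simp
    moreover have "set_tree (Node t' a r) = insert x (set_tree (Node l a r))" using t'(3) by auto
    moreover have "free_slots u (Node t' a r) = free_slots u (Node l a r) - {#v#} + {#x, x#}"
      using t'(4) 1 by simp
    ultimately show ?thesis by blast
  next
    case 2
    with ge[of v a r] Node.prems have "a \<le> x" by auto
    with Node.IH(2)[of a] 2 Node.prems obtain t' where t': "attach x r t'" "heap t'"
      "set_tree t' = insert x (set_tree r)" "free_slots a t' = free_slots a r - {#v#} + {#x, x#}" by auto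
    have "attach x (Node l a r) (Node l a t')" using t'(1) by (rule attach.right)
    moreover have "heap (Node l a t')" using Node.prems(1) t'(2,3) \<open>a \<le> x\<close> by simp
    moreover have "set_tree (Node l a t') = insert x (set_tree (Node l a r))" using t'(3) by auto
    moreover have "free_slots u (Node l a t') = free_slots u (Node l a r) - {#v#} + {#x, x#}"
      using t'(4) 2 by simp
    ultimately show ?thesis by blast
  qed
qed

lemma heapable_imp_fits: "heapable xs \<Longrightarrow> \<exists>M. fits {#0#} xs M"
proof -
  have "builds xs t \<Longrightarrow> fits {#0#} xs (free_slots 0 t)" for t
  proof (induction rule: builds.induct)
    case empty
    then show ?case by (simp add: fits.Nil)
  next
    case (step xs t x t')
    with heap_attach[of x t t' 0] show ?case using fits_snoc by auto
  qed
  then show "heapable xs \<Longrightarrow> \<exists>M. fits {#0#} xs M" by (auto simp: heapable_def)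
qed

section \<open>Vertices, parents and binary trees in the permutation DAG\<close>

definition vval :: "nat list \<Rightarrow> nat \<Rightarrow> nat" where
  "vval \<tau> v = (if v = 0 then 0 else \<tau> ! (v - 1))"

text \<open>
  In \<open>assigns \<tau> vs ps N\<close>, the vertices \<open>vs\<close> have been attached below the parents \<open>ps\<close>, and \<open>N\<close>
  is the multiset of the vertices having a free child position. The fictitious vertex \<open>0\<close> has a
  single position, for the root.
\<close>

inductive assigns :: "nat list \<Rightarrow> nat list \<Rightarrow> nat list \<Rightarrow> nat multiset \<Rightarrow> bool" for \<tau> where
  init: "assigns \<tau> [] [] {#0#}"
| attach: "assigns \<tau> vs ps N \<Longrightarrow> p \<in># N \<Longrightarrow> \<forall>u \<in> set vs. u < v \<Longrightarrow> 0 < v \<Longrightarrow> v \<le> length \<tau> \<Longrightarrow>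
    vval \<tau> p \<le> vval \<tau> v \<Longrightarrow> assigns \<tau> (vs @ [v]) (ps @ [p]) (N - {#p#} + {#v, v#})"

text \<open>The count equation is a conservation law: every vertex owns two positions and the
  fictitious one owns one, each either free or occupied by a child. The degree bound and the
  uniqueness of the root both come from it.\<close>

lemma assigns_basic:
  assumes "assigns \<tau> vs ps N"
  shows "length ps = length vs" "sorted_wrt (<) vs" "set vs \<subseteq> {1..length \<tau>}"
    "set_mset N \<subseteq> insert 0 (set vs)"
    "count N u + count_list ps u = (if u = 0 then 1 else if u \<in> set vs then 2 else 0)"
    "(v, p) \<in> set (zip vs ps) \<Longrightarrow> p \<noteq> 0 \<Longrightarrow> p \<in> set vs \<and> p < v \<and> vval \<tau> p \<le> vval \<tau> v"
proof -
  have "length ps = length vs \<and> sorted_wrt (<) vs \<and> set vs \<subseteq> {1..length \<tau>} \<and>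
    set_mset N \<subseteq> insert 0 (set vs) \<and>
    (\<forall>u. count N u + count_list ps u = (if u = 0 then 1 else if u \<in> set vs then 2 else 0)) \<and>
    (\<forall>v p. (v, p) \<in> set (zip vs ps) \<longrightarrow> p \<noteq> 0 \<longrightarrow> p \<in> set vs \<and> p < v \<and> vval \<tau> p \<le> vval \<tau> v)"
    using assms
  proof (induction rule: assigns.induct)
    case init
    then show ?case by simp
  next
    case (attach vs ps N p v)
    have "v \<notin> set vs" using attach.hyps by auto
    have c: "count (N - {#p#} + {#v, v#}) u + count_list (ps @ [p]) u =
      (if u = 0 then 1 else if u \<in> set (vs @ [v]) then 2 else 0)" for u
    proof -
      have "count N p > 0" using attach.hyps by simp
      moreover have "count N u + count_list ps u = (if u = 0 then 1 else if u \<in> set vs then 2 else 0)"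
        using attach.IH by blast
      ultimately show ?thesis using \<open>v \<notin> set vs\<close> \<open>0 < v\<close>
        by (cases "u = p"; cases "u = v") (auto split: if_splits simp del: count_greater_zero_iff)
    qed
    have "set_mset (N - {#p#} + {#v, v#}) \<subseteq> insert 0 (set (vs @ [v]))"
      using attach.IH by (auto dest: in_diffD)
    moreover have "(w, q) \<in> set (zip (vs @ [v]) (ps @ [p])) \<longrightarrow> q \<noteq> 0 \<longrightarrow>
      q \<in> set (vs @ [v]) \<and> q < w \<and> vval \<tau> q \<le> vval \<tau> w" for w q
      using attach by auto
    ultimately show ?case using attach c by (auto simp: sorted_wrt_append)
  qed
  then show "length ps = length vs" "sorted_wrt (<) vs" "set vs \<subseteq> {1..length \<tau>}"
    "set_mset N \<subseteq> insert 0 (set vs)"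
    "count N u + count_list ps u = (if u = 0 then 1 else if u \<in> set vs then 2 else 0)"
    "(v, p) \<in> set (zip vs ps) \<Longrightarrow> p \<noteq> 0 \<Longrightarrow> p \<in> set vs \<and> p < v \<and> vval \<tau> p \<le> vval \<tau> v"
    by blast+
qed

lemma image_mset_replace:
  "p \<in># N \<Longrightarrow> image_mset f (N - {#p#} + {#v, v#}) = image_mset f N - {#f p#} + {#f v, f v#}"
  by (simp add: image_mset_Diff)

lemma assigns_imp_fits:
  "assigns \<tau> vs ps N \<Longrightarrow> fits {#0#} (map (vval \<tau>) vs) (image_mset (vval \<tau>) N)"
proof (induction rule: assigns.induct)
  case init
  then show ?case by (simp add: fits.Nil vval_def)
next
  case (attach vs ps N p v)
  then show ?case
    using fits_snoc[OF attach.IH, of "vval \<tau> p" "vval \<tau> v"] by (simp only: image_mset_replace) auto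
qed

text \<open>Vertices of equal value cannot be told apart in the tree, but only the multiset of
  labels of free positions matters, so a tree realising the image of \<open>N\<close> under
  \<open>vval\<close> can always be extended.\<close>

lemma assigns_imp_heapable:
  assumes "assigns \<tau> vs ps N"
  shows "heapable (map (vval \<tau>) vs)"
proof -
  have "\<exists>t. builds (map (vval \<tau>) vs) t \<and> heap t \<and> free_slots 0 t = image_mset (vval \<tau>) N"
    using assms
  proof (induction rule: assigns.induct)
    case init
    then show ?case by (auto intro!: exI[of _ Leaf] builds.intros simp: vval_def)
  next
    case (attach vs ps N p v)
    then obtain t where t: "builds (map (vval \<tau>) vs) t" "heap t"
      "free_slots 0 t = image_mset (vval \<tau>) N" by blast
    moreover have "vval \<tau> p \<in># free_slots 0 t" using t(3) attach.hyps by simp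
    ultimately obtain t' where "attach (vval \<tau> v) t t'" "heap t'"
      "free_slots 0 t' = free_slots 0 t - {#vval \<tau> p#} + {#vval \<tau> v, vval \<tau> v#}"
      using attach_free_slot[of t "vval \<tau> p" 0 "vval \<tau> v"] attach.hyps by auto
    then show ?case using t attach.hyps builds.step[OF t(1), of "vval \<tau> v" t']
      by (simp only: image_mset_replace) auto
  qed
  then show ?thesis by (auto simp: heapable_def)
qed

text \<open>A strictly increasing list of indices is what its own set of members filters out of the
  list of all indices.\<close>

lemma subseq_increasing_positions:
  assumes "sorted_wrt (<) vs" "set vs \<subseteq> {1..length \<tau>}"
  shows "subseq (map (vval \<tau>) vs) \<tau>"
proof -
  have eq: "vs = filter (\<lambda>v. v \<in> set vs) [1..<Suc (length \<tau>)]"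
  proof (rule sorted_distinct_set_unique)
    show "sorted vs" "distinct vs" using assms(1) strict_sorted_iff by auto
    show "set vs = set (filter (\<lambda>v. v \<in> set vs) [1..<Suc (length \<tau>)])" using assms(2) by auto
  qed (auto simp: sorted_wrt_filter simp del: upt_Suc)
  have "subseq (map (vval \<tau>) vs) (map (vval \<tau>) [1..<Suc (length \<tau>)])"
    by (subst eq) (auto intro!: subseq_map)
  also have "map (vval \<tau>) [1..<Suc (length \<tau>)] = \<tau>"
    by (rule nth_equalityI) (auto simp: vval_def simp del: upt_Suc)
  finally show ?thesis .
qed

lemma card_children:
  assumes "distinct vs" "length ps = length vs"
  shows "card {(w, p). (w, p) \<in> set (zip vs ps) \<and> p = v} = count_list ps v"
  using assms(2,1)
proof (induction ps vs rule: list_induct2)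
  case (Cons p ps w vs)
  have eq: "{(w', p'). (w', p') \<in> set (zip (w # vs) (p # ps)) \<and> p' = v} =
    (if p = v then insert (w, v) else id) {(w', p'). (w', p') \<in> set (zip vs ps) \<and> p' = v}"
    by auto
  have "finite {(w', p'). (w', p') \<in> set (zip vs ps) \<and> p' = v}"
    by (rule finite_subset[of _ "set (zip vs ps)"]) auto
  moreover have "(w, v) \<notin> {(w', p'). (w', p') \<in> set (zip vs ps) \<and> p' = v}"
    using Cons.prems by (auto dest: set_zip_leftD)
  ultimately show ?case using Cons unfolding eq by (simp del: mem_Collect_eq)
qed simp

lemma assigns_imp_rooted_binary_tree:
  assumes asg: "assigns \<tau> vs ps N" and ne: "vs \<noteq> []"
  shows "\<exists>r. rooted_binary_tree (PermDAG \<tau>) r (parent_graph vs ps)"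
proof -
  note b = assigns_basic[OF asg]
  let ?T = "parent_graph vs ps"
  have dist: "distinct vs" using b(2) strict_sorted_iff by auto
  have arcs: "(v, p) \<in> arcs ?T \<longleftrightarrow> (v, p) \<in> set (zip vs ps) \<and> p \<noteq> 0" for v p
    by (simp add: parent_graph_def)
  have [simp]: "verts ?T = set vs" "tail ?T = fst" "head ?T = snd" by (simp_all add: parent_graph_def)
  have par: "\<exists>p. (v, p) \<in> set (zip vs ps)" if "v \<in> set vs" for v
    using that b(1) by (metis in_set_impl_in_set_zip1)
  have par_unique: "p = q" if "(v, p) \<in> set (zip vs ps)" "(v, q) \<in> set (zip vs ps)" for v p q
    using that dist b(1) by (metis eq_key_imp_eq_value map_fst_zip)
  interpret T: wf_digraph ?T
    using b(6) by unfold_locales (auto simp: arcs dest: set_zip_leftD)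
  have arc_lt: "p < v" if "(v, p) \<in> arcs ?T" for v p using that b(6) by (auto simp: arcs)
  have wfG: "wf_digraph (PermDAG \<tau>)" by unfold_locales (auto simp: PermDAG_def)
  have "arcs ?T \<subseteq> arcs (PermDAG \<tau>)"
  proof
    fix e assume "e \<in> arcs ?T"
    then obtain v p where e: "e = (v, p)" "(v, p) \<in> set (zip vs ps)" "p \<noteq> 0"
      by (cases e) (auto simp: arcs)
    then have "v \<in> set vs" by (auto dest: set_zip_leftD)
    then show "e \<in> arcs (PermDAG \<tau>)" using b(6)[OF e(2,3)] b(3) e
      by (auto simp: PermDAG_def vval_def)
  qed
  then have sub: "subgraph ?T (PermDAG \<tau>)"
    using b(3) wfG T.wf_digraph by (auto simp: subgraph_def compatible_def PermDAG_def)
  have "card {(w, p). (w, p) \<in> set (zip vs ps) \<and> p = 0} \<le> 1"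
    using card_children[OF dist b(1), of 0] b(5)[of 0] by simp
  moreover have fin: "finite {(w, p). (w, p) \<in> set (zip vs ps) \<and> p = v}" for v
    by (rule finite_subset[of _ "set (zip vs ps)"]) auto
  ultimately have root_unique: "v = w" if "(v, 0) \<in> set (zip vs ps)" "(w, 0) \<in> set (zip vs ps)" for v w
    using that by (force simp: card_le_Suc0_iff_eq)
  have "Min (set vs) \<in> set vs" using ne by simp
  then obtain p where p: "(Min (set vs), p) \<in> set (zip vs ps)" using par by blast
  \<comment> \<open>A nonzero parent would be a smaller vertex of \<open>vs\<close>, against
    minimality.\<close>
  have "p = 0"
    using b(6)[OF p] Min_le[of "set vs" p] by fastforce
  define r where "r = Min (set vs)"
  have r: "(r, 0) \<in> set (zip vs ps)" "r \<in> set vs" using p \<open>p = 0\<close> \<open>Min (set vs) \<in> set vs\<close> r_def by auto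
  have leaf: "v \<in> verts ?T \<and> out_arcs ?T v = {} \<longleftrightarrow> v = r" for v
  proof
    assume v: "v \<in> verts ?T \<and> out_arcs ?T v = {}"
    then obtain q where q: "(v, q) \<in> set (zip vs ps)" using par by auto
    have "(v, q) \<notin> arcs ?T" using v by (force simp: out_arcs_def)
    with q have "q = 0" by (auto simp: arcs)
    with q r root_unique show "v = r" by blast
  next
    assume "v = r"
    then show "v \<in> verts ?T \<and> out_arcs ?T v = {}"
      using r par_unique by (auto simp: out_arcs_def arcs)
  qed
  \<comment> \<open>Arcs lead to smaller vertices, which permits induction on the vertex; the path
    is unique since every vertex other than \<open>r\<close> has only one outgoing arc.\<close>
  have path: "\<exists>!es. T.apath v es r" if "v \<in> set vs" for v
    using that
  proof (induction v rule: less_induct)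
    case (less v)
    \<comment> \<open>No vertex on a path exceeds its start, so prepending \<open>v\<close> to a
      path from its smaller parent cannot repeat \<open>v\<close>.\<close>
    have below: "u \<le> w" if "T.apath w es r" "u \<in> set (T.awalk_verts w es)" for w es u
      using that
    proof (induction es arbitrary: w)
      case (Cons e es)
      then have "e \<in> arcs ?T" "fst e = w" "T.apath (snd e) es r"
        "u = w \<or> u \<in> set (T.awalk_verts (snd e) es)"
        by (auto simp: T.apath_Cons_iff)
      then show ?case using Cons.IH[of "snd e"] arc_lt[of "fst e" "snd e"] by auto
    qed simp
    show ?case
    proof (cases "v = r")
      case True
      have "es = []" if "T.apath v es r" for es
        using that leaf[of v] True by (cases es) (auto simp: T.apath_Cons_iff out_arcs_def)
      moreover have "T.apath v [] r" using True less.prems by (simp add: T.apath_Nil_iff)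
      ultimately show ?thesis by blast
    next
      case False
      then obtain e where e: "e \<in> arcs ?T" "fst e = v" using leaf[of v] less.prems
        by (auto simp: out_arcs_def)
      have uniq: "e' = e" if "e' \<in> arcs ?T" "fst e' = v" for e'
        using e that par_unique by (cases e; cases e') (auto simp: arcs)
      have lt: "snd e < v" "snd e \<in> set vs"
        using e arc_lt[of v "snd e"] T.head_in_verts[OF e(1)] by (cases e; simp)+
      obtain es where es: "T.apath (snd e) es r" "\<forall>es'. T.apath (snd e) es' r \<longrightarrow> es' = es"
        using less.IH[OF lt] by (elim ex1E) (rule that)
      have "v \<notin> set (T.awalk_verts (snd e) es)" using below[OF es(1), of v] lt(1) by linarith
      then have "T.apath v (e # es) r" using e es(1) by (simp add: T.apath_Cons_iff)
      moreover have "es' = e # es" if "T.apath v es' r" for es'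
      proof (cases es')
        case (Cons e' es'')
        with that have "e' \<in> arcs ?T" "fst e' = v" "T.apath (snd e') es'' r"
          by (simp_all add: T.apath_Cons_iff)
        then show ?thesis using Cons uniq es(2) by metis
      qed (use that False in \<open>simp add: T.apath_Nil_iff\<close>)
      ultimately show ?thesis by blast
    qed
  qed
  have deg: "finite (in_arcs ?T v) \<and> in_degree ?T v \<le> 2" for v
  proof -
    have sub: "in_arcs ?T v \<subseteq> {(w, p). (w, p) \<in> set (zip vs ps) \<and> p = v}"
      by (auto simp: in_arcs_def arcs)
    have "card (in_arcs ?T v) \<le> count_list ps v"
      using card_mono[OF fin sub] card_children[OF dist b(1), of v] by simp
    moreover have "count_list ps v \<le> 2" using b(5)[of v] by (auto split: if_splits)
    ultimately show ?thesis using finite_subset[OF sub fin] by (simp add: in_degree_def)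
  qed
  show ?thesis unfolding rooted_binary_tree_def using sub leaf path deg by (intro exI[of _ r]) simp
qed

text \<open>Arcs point to smaller indices, so adding the vertices in increasing order always finds
  the parent already present.\<close>

lemma rooted_binary_tree_imp_assigns:
  assumes T: "rooted_binary_tree (PermDAG \<tau>) r T"
  shows "\<exists>vs ps N. assigns \<tau> vs ps N \<and> length vs = card (verts T)"
proof -
  have sub: "subgraph T (PermDAG \<tau>)" using T by (simp add: rooted_binary_tree_def)
  then interpret T: wf_digraph T by auto
  have verts: "verts T \<subseteq> {1..length \<tau>}" and arcs: "arcs T \<subseteq> arcs (PermDAG \<tau>)"
    and ht: "head T = snd" "tail T = fst"
    using sub by (auto simp: subgraph_def compatible_def PermDAG_def)
  have fin: "finite (verts T)" using verts finite_subset by blast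
  have "\<exists>q. v \<noteq> r \<longrightarrow> (v, q) \<in> arcs T" if "v \<in> verts T" for v
    using T that by (fastforce simp: rooted_binary_tree_def out_arcs_def ht)
  then obtain q where q: "\<And>v. v \<in> verts T \<Longrightarrow> v \<noteq> r \<Longrightarrow> (v, q v) \<in> arcs T" by metis
  define p where "p v = (if v = r then 0 else q v)" for v
  have r: "r \<in> verts T" using T by (auto simp: rooted_binary_tree_def)
  have par: "p v \<in> verts T \<and> p v < v \<and> vval \<tau> (p v) \<le> vval \<tau> v" if "v \<in> verts T" "v \<noteq> r" for v
  proof -
    have "(v, q v) \<in> arcs T" using q that by auto
    moreover from this have "(v, q v) \<in> arcs (PermDAG \<tau>)" using arcs by auto
    moreover have "q v \<in> verts T" using calculation(1) T.head_in_verts ht by fastforce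
    ultimately show ?thesis using that by (auto simp: p_def PermDAG_def vval_def)
  qed
  \<comment> \<open>This capacity bound keeps positions from running out: for a vertex it is the
    in-degree condition, for the fictitious vertex it says that only \<open>r\<close> is
    parentless.\<close>
  have kids: "card {v \<in> verts T. p v = u} \<le> (if u = 0 then 1 else 2)" for u
  proof (cases "u = 0")
    case True
    have "{v \<in> verts T. p v = u} \<subseteq> {r}" using par verts True by force
    then show ?thesis using True card_mono[of "{r}"] by fastforce
  next
    case False
    show ?thesis
    proof (cases "u \<in> verts T")
      case True
      have "(\<lambda>v. (v, u)) ` {v \<in> verts T. p v = u} \<subseteq> in_arcs T u"
        using q False by (auto simp: in_arcs_def ht p_def split: if_splits)
      moreover have "finite (in_arcs T u)" "card (in_arcs T u) \<le> 2"
        using T True by (auto simp: rooted_binary_tree_def in_degree_def)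
      ultimately have "card {v \<in> verts T. p v = u} \<le> 2"
        using card_inj_on_le[of "\<lambda>v. (v, u)" "{v \<in> verts T. p v = u}" "in_arcs T u"]
        by (auto simp: inj_on_def)
      then show ?thesis using False by simp
    next
      case uT: False
      have "{v \<in> verts T. p v = u} = {}" using par uT False by (auto simp: p_def split: if_splits)
      then show ?thesis by (simp only: card.empty)
    qed
  qed
  let ?vs = "sorted_list_of_set (verts T)"
  have "\<exists>N. assigns \<tau> (take i ?vs) (map p (take i ?vs)) N" if "i \<le> length ?vs" for i
    using that
  proof (induction i)
    case 0
    show ?case using assigns.init by auto
  next
    case (Suc i)
    then obtain N where N: "assigns \<tau> (take i ?vs) (map p (take i ?vs)) N" by auto
    let ?v = "?vs ! i"
    have i: "i < length ?vs" using Suc.prems by simp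
    then have v: "?v \<in> verts T" using nth_mem[OF i] fin by simp
    have sorted: "sorted_wrt (<) ?vs" by simp
    have before: "u < ?v" if "u \<in> set (take i ?vs)" for u
      using that i sorted_wrt_nth_less[OF sorted] by (auto simp: in_set_conv_nth)
    have mem_before: "u \<in> set (take i ?vs)" if u: "u \<in> verts T" "u < ?v" for u
    proof -
      from u fin obtain j where j: "j < length ?vs" "?vs ! j = u"
        by (metis in_set_conv_nth set_sorted_list_of_set)
      have "j < i"
      proof (rule ccontr)
        assume "\<not> j < i"
        then show False using sorted_wrt_nth_less[OF sorted, of i j] j u by (cases "i = j") auto
      qed
      with j i show ?thesis by (auto simp: in_set_conv_nth intro!: exI[of _ j])
    qed
    have "distinct (take i ?vs)" by simp
    have cl: "count_list (map p ws) u = card {v \<in> set ws. p v = u}" if "distinct ws" for ws u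
      using that
    proof (induction ws)
      case (Cons w ws)
      have "{v \<in> set (w # ws). p v = u} = (if p w = u then insert w else id) {v \<in> set ws. p v = u}"
        by auto
      with Cons show ?case by auto
    qed simp
    \<comment> \<open>The vertex about to be added is itself a child of \<open>p ?v\<close> not yet
      counted, so the number of occupied positions is strictly below the capacity.\<close>
    have sub: "insert ?v {v \<in> set (take i ?vs). p v = p ?v} \<subseteq> {v \<in> verts T. p v = p ?v}"
      using v set_take_subset[of i ?vs] fin by auto
    have "?v \<notin> set (take i ?vs)" using before by blast
    then have "Suc (card {v \<in> set (take i ?vs). p v = p ?v}) = card (insert ?v {v \<in> set (take i ?vs). p v = p ?v})"
      by simp
    also have "\<dots> \<le> card {v \<in> verts T. p v = p ?v}"
      by (rule card_mono) (use sub fin in auto)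
    finally have "card {v \<in> set (take i ?vs). p v = p ?v} < (if p ?v = 0 then 1 else 2)"
      using kids[of "p ?v"] by simp
    moreover have "p ?v \<noteq> 0 \<longrightarrow> p ?v \<in> set (take i ?vs)"
      using par[OF v] mem_before by (auto simp: p_def split: if_splits)
    ultimately have "count N (p ?v) > 0"
      using assigns_basic(5)[OF N, of "p ?v", unfolded cl[OF \<open>distinct (take i ?vs)\<close>]]
      by (cases "p ?v = 0") (presburger | simp only: if_True if_False simp_thms)+
    \<comment> \<open>For the root the parent is the fictitious vertex, whose value 0 is the least
      natural number and imposes no restriction.\<close>
    moreover have "vval \<tau> (p ?v) \<le> vval \<tau> ?v"
      using par[OF v] by (cases "?v = r") (auto simp: p_def vval_def)
    ultimately have "assigns \<tau> (take i ?vs @ [?v]) (map p (take i ?vs) @ [p ?v]) (N - {#p ?v#} + {#?v, ?v#})"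
      using N before v verts by (intro assigns.attach) auto
    then show ?case using i by (auto simp: take_Suc_conv_app_nth)
  qed
  from this[of "length ?vs"] obtain N where "assigns \<tau> ?vs (map p ?vs) N" by auto
  moreover have "length ?vs = card (verts T)" by simp
  ultimately show ?thesis by blast
qed

section \<open>Truncated counts of free positions\<close>

definition slot_count :: "nat multiset \<Rightarrow> nat \<Rightarrow> nat" where
  "slot_count M m = size (filter_mset (\<lambda>v. v \<le> m) M)"

text \<open>
  A state \<open>d\<close> records, for every rank \<open>m\<close>, the number of free positions usable by an element of
  rank \<open>m\<close>, truncated at \<open>m\<close>. Attaching an element of rank \<open>x\<close> at the greatest possible position
  changes the untruncated count \<open>c m\<close>, for \<open>m < x\<close>, to the minimum of \<open>c m\<close> and \<open>c x - 1\<close>. As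
  \<open>m \<le> x - 1\<close>, its truncation at \<open>m\<close> only depends on the truncation of \<open>c x\<close> at \<open>x\<close>: truncating
  loses nothing.
\<close>

definition upd :: "nat \<Rightarrow> (nat \<Rightarrow> nat) \<Rightarrow> nat \<Rightarrow> nat" where
  "upd x d m = (if m < x then if d m < d x then d m else d m - 1 else if d m < m then d m + 1 else d m)"

fun best :: "nat list \<Rightarrow> (nat \<Rightarrow> nat) \<Rightarrow> nat" where
  "best [] d = 0"
| "best (x # xs) d = (if 0 < d x then max (best xs d) (Suc (best xs (upd x d))) else best xs d)"

lemma slot_count_mono: "m \<le> m' \<Longrightarrow> slot_count M m \<le> slot_count M m'"
  unfolding slot_count_def by (intro size_mset_mono filter_mset_mono_strong) auto

lemma slot_count_less:
  assumes "v \<in># M" "m < v" "v \<le> m'"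
  shows "slot_count M m < slot_count M m'"
proof -
  obtain M' where M: "M = add_mset v M'" using assms by (metis insert_DiffM)
  show ?thesis using assms slot_count_mono[of m m' M'] unfolding slot_count_def M by auto
qed

lemma slot_count_replace:
  assumes "v \<in># M" "v \<le> x"
  shows "slot_count (M - {#v#} + {#x, x#}) m =
    (if x \<le> m then Suc (slot_count M m) else if v \<le> m then slot_count M m - 1 else slot_count M m)"
proof -
  obtain M' where M: "M = add_mset v M'" using assms by (metis insert_DiffM)
  show ?thesis using assms unfolding slot_count_def M by auto
qed

lemma slot_count_pos: "v \<in># M \<Longrightarrow> v \<le> m \<Longrightarrow> 0 < slot_count M m"
  unfolding slot_count_def by (auto simp: multiset_eq_iff nonempty_has_size[symmetric] intro!: exI[of _ v])

text \<open>The delicate ranks are those \<open>m < z\<close> at which \<open>upd\<close>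
  decrements. There the new count is at most the old count at \<open>z\<close> minus one: either
  \<open>m\<close> loses the consumed position itself, or \<open>v\<close> lies above
  \<open>m\<close> and counted for \<open>z\<close> only.\<close>

lemma best_upper:
  assumes "fits M ys M'" "subseq ys zs" "\<And>m. min m (slot_count M m) \<le> d m" "0 \<notin> set zs"
  shows "length ys \<le> best zs d"
  using assms
proof (induction zs arbitrary: M ys d)
  case (Cons z zs)
  show ?case
  proof (cases "ys \<noteq> [] \<and> hd ys = z")
    case False
    then have "subseq ys zs" using Cons.prems(2) by (cases ys) auto
    then show ?thesis using Cons.IH[OF Cons.prems(1), of d] Cons.prems(3,4) by auto
  next
    case True
    then obtain xs where ys: "ys = z # xs" by (cases ys) auto
    with Cons.prems(1) obtain v where v: "v \<in># M" "v \<le> z" "fits (M - {#v#} + {#z, z#}) xs M'"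
      by (auto elim: fits.cases)
    \<comment> \<open>Ranks are positive, so truncation at \<open>z\<close> cannot hide the
      available position.\<close>
    have "0 < min z (slot_count M z)" using slot_count_pos[OF v(1,2)] Cons.prems(4) by auto
    then have "0 < d z" using Cons.prems(3)[of z] by linarith
    have "min m (slot_count (M - {#v#} + {#z, z#}) m) \<le> upd z d m" for m
    proof -
      have "min m (slot_count M m) \<le> d m" "min z (slot_count M z) \<le> d z" using Cons.prems(3) by auto
      moreover have "slot_count M m < slot_count M z" if "m < v" using slot_count_less[OF v(1) that v(2)] .
      moreover have "slot_count M m \<le> slot_count M z" if "m \<le> z" using slot_count_mono that .
      ultimately show ?thesis using v(2)
        unfolding slot_count_replace[OF v(1,2)] upd_def
        by (cases "z \<le> m"; cases "v \<le> m"; cases "d m < d z"; simp) linarith+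
    qed
    then have "length xs \<le> best zs (upd z d)"
      using Cons.IH[OF v(3), of "upd z d"] Cons.prems(2,4) ys by auto
    then show ?thesis using \<open>0 < d z\<close> ys by auto
  qed
qed simp

text \<open>Digit arrays and codes determine a state only on the ranks \<open>1, ..., k\<close>, so
  \<open>best\<close> must not depend on anything else.\<close>

lemma best_cong:
  assumes "\<forall>m \<in> {1..k}. d m = d' m" "set xs \<subseteq> {1..k}"
  shows "best xs d = best xs d'"
  using assms
proof (induction xs arbitrary: d d')
  case (Cons x xs)
  then have "d x = d' x" by auto
  moreover have "best xs (upd x d) = best xs (upd x d')"
    using Cons.prems \<open>d x = d' x\<close> by (intro Cons.IH) (auto simp: upd_def)
  moreover have "best xs d = best xs d'" using Cons by auto
  ultimately show ?case by simp
qed simp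

text \<open>As \<open>v\<close> is the greatest usable label, the counts at all \<open>m\<close>
  with \<open>v \<le> m \<le> x\<close> agree, and those at \<open>m < v\<close> are strictly
  smaller. Comparing digits thus identifies, up to truncation, the ranks that lose a
  position.\<close>

lemma upd_exact:
  assumes "v \<in># M" "v \<le> x" "\<And>w. w \<in># M \<Longrightarrow> w \<le> x \<Longrightarrow> w \<le> v"
    and d: "d m = min m (slot_count M m)" "d x = min x (slot_count M x)"
  shows "upd x d m = min m (slot_count (M - {#v#} + {#x, x#}) m)"
proof -
  have "slot_count M m < slot_count M x" if "m < v" using slot_count_less[OF assms(1) that assms(2)] .
  moreover have "slot_count M m = slot_count M x" if "v \<le> m" "m \<le> x"
    unfolding slot_count_def using that assms(3)
    by (intro arg_cong[of _ _ size] filter_mset_cong refl) (meson order.trans)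
  moreover have "0 < slot_count M x" using slot_count_pos assms by blast
  ultimately show ?thesis
    unfolding slot_count_replace[OF assms(1,2)] upd_def d using assms(2)
    by (cases "x \<le> m"; cases "v \<le> m"; simp) linarith+
qed

section \<open>Ranks and the common optimum of both problems\<close>

definition rank :: "nat list \<Rightarrow> nat \<Rightarrow> nat" where
  "rank \<tau> y = card {v \<in> set \<tau>. v \<le> y}"

lemma mono_rank: "mono (rank \<tau>)"
  unfolding rank_def by (intro monoI card_mono) auto

lemma rank_le_iff: "x \<in> set \<tau> \<Longrightarrow> rank \<tau> x \<le> rank \<tau> y \<longleftrightarrow> x \<le> y"
proof
  assume x: "x \<in> set \<tau>" "rank \<tau> x \<le> rank \<tau> y"
  show "x \<le> y"
  proof (rule ccontr)
    assume "\<not> x \<le> y"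
    then have "{v \<in> set \<tau>. v \<le> y} \<subset> {v \<in> set \<tau>. v \<le> x}" using x by auto
    then have "rank \<tau> y < rank \<tau> x" unfolding rank_def by (intro psubset_card_mono) auto
    then show False using x by simp
  qed
qed (use mono_rank in \<open>auto dest: monoD\<close>)

lemma rank_range: "x \<in> set \<tau> \<Longrightarrow> rank \<tau> x \<in> {1..card (set \<tau>)}"
proof -
  assume "x \<in> set \<tau>"
  then have "card {v \<in> set \<tau>. v \<le> x} > 0" by (subst card_gt_0_iff) auto
  moreover have "card {v \<in> set \<tau>. v \<le> x} \<le> card (set \<tau>)" by (intro card_mono) auto
  ultimately show ?thesis by (auto simp: rank_def)
qed

lemma fits_le_best:
  assumes "fits {#0#} ys M" "subseq ys \<tau>"
  shows "length ys \<le> best (map (rank \<tau>) \<tau>) (\<lambda>_. 1)"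
proof -
  have "fits {#rank \<tau> 0#} (map (rank \<tau>) ys) (image_mset (rank \<tau>) M)"
    using fits_map[OF assms(1) mono_rank] by simp
  moreover have "subseq (map (rank \<tau>) ys) (map (rank \<tau>) \<tau>)" using assms(2) by (rule subseq_map)
  \<comment> \<open>Only the root position is free at the start, so the constant state 1 dominates,
    whether or not 0 occurs in the sequence and has rank 1.\<close>
  moreover have "slot_count {#rank \<tau> 0#} m \<le> 1" for m by (simp add: slot_count_def)
  moreover have "0 \<notin> set (map (rank \<tau>) \<tau>)" using rank_range by fastforce
  ultimately show ?thesis using best_upper[of "{#rank \<tau> 0#}" "map (rank \<tau>) ys" _ "map (rank \<tau>) \<tau>" "\<lambda>_. 1"]
    by (simp add: min.coboundedI2)
qed

text \<open>Heapable subsequences and trees in the DAG are both bounded by \<open>best\<close>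
  through \<open>fits\<close>, so one attachment of that length is optimal for both. A rooted tree
  contains its root, hence the restriction to nonempty sequences in the second claim.\<close>

lemma assigns_optimal:
  assumes asg: "assigns \<tau> vs ps N" and len: "length vs = best (map (rank \<tau>) \<tau>) (\<lambda>_. 1)"
  shows "longest_heapable_subseq (map (vval \<tau>) vs) \<tau>"
    and "\<tau> \<noteq> [] \<Longrightarrow> maximum_binary_tree (PermDAG \<tau>) (parent_graph vs ps)"
proof -
  note b = assigns_basic[OF asg]
  show "longest_heapable_subseq (map (vval \<tau>) vs) \<tau>"
    unfolding longest_heapable_subseq_def
    using assigns_imp_heapable[OF asg] subseq_increasing_positions[OF b(2,3)] heapable_imp_fits
      fits_le_best len by fastforce
  assume "\<tau> \<noteq> []"
  then obtain y ys where "\<tau> = y # ys" by (cases \<tau>) auto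
  \<comment> \<open>The first element meets a state with digit 1 at its rank, so \<open>best\<close>
    is positive.\<close>
  then have "vs \<noteq> []" using len by auto
  moreover have "card (verts T) \<le> length vs" if "rooted_binary_tree (PermDAG \<tau>) r T" for r T
  proof -
    obtain vs' ps' N' where a: "assigns \<tau> vs' ps' N'" "length vs' = card (verts T)"
      using rooted_binary_tree_imp_assigns \<open>rooted_binary_tree (PermDAG \<tau>) r T\<close> by blast
    have "length (map (vval \<tau>) vs') \<le> best (map (rank \<tau>) \<tau>) (\<lambda>_. 1)"
      by (intro fits_le_best[OF assigns_imp_fits[OF a(1)]] subseq_increasing_positions assigns_basic[OF a(1)])
    then show ?thesis using a len by simp
  qed
  moreover have "card (verts (parent_graph vs ps)) = length vs"
    using b(2) by (simp add: parent_graph_def distinct_card strict_sorted_iff)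
  ultimately show "maximum_binary_tree (PermDAG \<tau>) (parent_graph vs ps)"
    using assigns_imp_rooted_binary_tree[OF asg] by (auto simp: maximum_binary_tree_def)
qed

section \<open>Total correctness with time bounds\<close>

text \<open>An upper bound instead of the exact time lets branches and iterations of different cost
  be treated uniformly.\<close>

definition terminates :: "com \<Rightarrow> nat \<Rightarrow> (state \<Rightarrow> bool) \<Rightarrow> state \<Rightarrow> bool" where
  "terminates c b Q s \<longleftrightarrow> (\<exists>t s'. exec c s t s' \<and> t \<le> b \<and> Q s')"

fun written_regs :: "com \<Rightarrow> nat set" where
  "written_regs (SetReg x e) = {x}"
| "written_regs (Seq c d) = written_regs c \<union> written_regs d"
| "written_regs (IfLess e f c d) = written_regs c \<union> written_regs d"
| "written_regs (WhileLess e f c) = written_regs c"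
| "written_regs _ = {}"

fun written_arrs :: "com \<Rightarrow> nat set" where
  "written_arrs (SetArr a i e) = {a}"
| "written_arrs (Seq c d) = written_arrs c \<union> written_arrs d"
| "written_arrs (IfLess e f c d) = written_arrs c \<union> written_arrs d"
| "written_arrs (WhileLess e f c) = written_arrs c"
| "written_arrs _ = {}"

text \<open>What a program may change is read off its syntax, so loop invariants need not mention
  the registers and arrays that stay fixed.\<close>

definition frame :: "com \<Rightarrow> state \<Rightarrow> state \<Rightarrow> bool" where
  "frame c s s' \<longleftrightarrow> (\<forall>x. x \<notin> written_regs c \<longrightarrow> fst s' x = fst s x) \<and>
     (\<forall>a. a \<notin> written_arrs c \<longrightarrow> snd s' a = snd s a)"

lemma exec_frame: "exec c s t s' \<Longrightarrow> frame c s s'"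
  by (induction rule: exec.induct) (auto simp: frame_def)

lemma frame_reg: "frame c s s' \<Longrightarrow> x \<notin> written_regs c \<Longrightarrow> fst s' x = fst s x"
  and frame_arr: "frame c s s' \<Longrightarrow> a \<notin> written_arrs c \<Longrightarrow> snd s' a = snd s a"
  by (auto simp: frame_def)

lemma terminates_frame:
  "terminates c b Q s \<Longrightarrow> terminates c b (\<lambda>s'. Q s' \<and> frame c s s') s"
  unfolding terminates_def using exec_frame by blast

lemma terminates_mono:
  "terminates c b Q s \<Longrightarrow> b \<le> b' \<Longrightarrow> (\<And>s'. Q s' \<Longrightarrow> Q' s') \<Longrightarrow> terminates c b' Q' s"
  unfolding terminates_def by (meson order.trans)

lemma terminates_Seq:
  assumes "terminates c b\<^sub>1 Q s" "\<And>s'. Q s' \<Longrightarrow> frame c s s' \<Longrightarrow> terminates d b\<^sub>2 R s'" "b\<^sub>1 + b\<^sub>2 \<le> b"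
  shows "terminates (Seq c d) b R s"
proof -
  from assms(1) obtain t s' where c: "exec c s t s'" "t \<le> b\<^sub>1" "Q s'" by (auto simp: terminates_def)
  with assms(2)[OF c(3) exec_frame[OF c(1)]] obtain u s'' where d: "exec d s' u s''" "u \<le> b\<^sub>2" "R s''"
    by (auto simp: terminates_def)
  moreover have "t + u \<le> b" using c(2) d(2) assms(3) by simp
  ultimately show ?thesis unfolding terminates_def using exec.Seq[OF c(1)] by blast
qed

text \<open>The measure bounds the number of iterations, and the extra 1 in the factor pays for the
  final failing test. The frame assumption ties each iteration to the state before the loop.\<close>

lemma terminates_While:
  fixes \<mu> :: "state \<Rightarrow> nat"
  assumes "I s\<^sub>0"
    and "\<And>s. I s \<Longrightarrow> frame c s\<^sub>0 s \<Longrightarrow> aval e s < aval f s \<Longrightarrow> terminates c b (\<lambda>s'. I s' \<and> \<mu> s' < \<mu> s) s"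
  shows "terminates (WhileLess e f c) ((\<mu> s\<^sub>0 + 1) * (b + 1 + acost e + acost f))
    (\<lambda>s. I s \<and> \<not> aval e s < aval f s) s\<^sub>0"
proof -
  have "terminates (WhileLess e f c) ((\<mu> s + 1) * (b + 1 + acost e + acost f))
    (\<lambda>s. I s \<and> \<not> aval e s < aval f s) s" if "I s" "frame c s\<^sub>0 s" for s
    using that
  proof (induction "\<mu> s" arbitrary: s rule: less_induct)
    case less
    show ?case
    proof (cases "aval e s < aval f s")
      case False
      moreover have "1 + acost e + acost f \<le> (\<mu> s + 1) * (b + 1 + acost e + acost f)" by simp
      ultimately show ?thesis
        unfolding terminates_def using less.prems(1) exec.WhileFalse[OF False, of c] by blast
    next
      case True
      from assms(2)[OF less.prems True] obtain t s' where s': "exec c s t s'" "t \<le> b" "I s'" "\<mu> s' < \<mu> s"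
        by (auto simp: terminates_def)
      have "frame c s\<^sub>0 s'" using exec_frame[OF s'(1)] less.prems(2) by (auto simp: frame_def)
      from less.hyps[OF s'(4,3) this] obtain u s'' where s'': "exec (WhileLess e f c) s' u s''"
        "u \<le> (\<mu> s' + 1) * (b + 1 + acost e + acost f)" "I s''" "\<not> aval e s'' < aval f s''"
        by (auto simp: terminates_def)
      have "(\<mu> s' + 1) * (b + 1 + acost e + acost f) \<le> \<mu> s * (b + 1 + acost e + acost f)"
        using s'(4) by (intro mult_right_mono) auto
      then have "1 + acost e + acost f + t + u \<le> (\<mu> s + 1) * (b + 1 + acost e + acost f)"
        using s''(2) s'(2) by (simp add: algebra_simps)
      then show ?thesis
        using exec.WhileTrue[OF True s'(1) s''(1)] s''(3,4) unfolding terminates_def by blast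
    qed
  qed
  then show ?thesis using assms(1) by (auto simp: frame_def)
qed

section \<open>Symbolic execution of loop-free programs\<close>

fun loop_free :: "com \<Rightarrow> bool" where
  "loop_free (Seq c d) \<longleftrightarrow> loop_free c \<and> loop_free d"
| "loop_free (IfLess e f c d) \<longleftrightarrow> loop_free c \<and> loop_free d"
| "loop_free (WhileLess e f c) \<longleftrightarrow> False"
| "loop_free _ \<longleftrightarrow> True"

fun run :: "com \<Rightarrow> state \<Rightarrow> state" where
  "run (SetReg x e) s = ((fst s)(x := aval e s), snd s)"
| "run (SetArr a i e) s = (fst s, (snd s)(a := (snd s a)(aval i s := aval e s)))"
| "run (Seq c d) s = run d (run c s)"
| "run (IfLess e f c d) s = (if aval e s < aval f s then run c s else run d s)"
| "run _ s = s"

fun cost_bound :: "com \<Rightarrow> nat" where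
  "cost_bound (SetReg x e) = 1 + acost e"
| "cost_bound (SetArr a i e) = 1 + acost i + acost e"
| "cost_bound (Seq c d) = cost_bound c + cost_bound d"
| "cost_bound (IfLess e f c d) = 1 + acost e + acost f + max (cost_bound c) (cost_bound d)"
| "cost_bound _ = 1"

lemma terminates_loop_free:
  assumes "loop_free c" "cost_bound c \<le> b" "Q (run c s)"
  shows "terminates c b Q s"
proof -
  have "\<exists>t \<le> cost_bound c. exec c s t (run c s)" using assms(1)
  proof (induction c arbitrary: s)
    case Skip
    then show ?case using exec.Skip[of s] by auto
  next
    case (SetReg x e)
    then show ?case using exec.SetReg[of x e s] by auto
  next
    case (SetArr a i e)
    then show ?case using exec.SetArr[of a i e s] by auto
  next
    case (Seq c d)
    then obtain t u where "t \<le> cost_bound c" "exec c s t (run c s)"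
      "u \<le> cost_bound d" "exec d (run c s) u (run d (run c s))" by fastforce
    then show ?case using exec.Seq by (intro exI[of _ "t + u"]) auto
  next
    case (IfLess e f c d)
    show ?case
    proof (cases "aval e s < aval f s")
      case True
      from IfLess obtain t where "t \<le> cost_bound c" "exec c s t (run c s)" by fastforce
      with exec.IfTrue[OF True this(2), of d] True show ?thesis
        by (intro exI[of _ "1 + acost e + acost f + t"]) auto
    next
      case False
      from IfLess obtain t where "t \<le> cost_bound d" "exec d s t (run d s)" by fastforce
      with exec.IfFalse[OF False this(2), of c] False show ?thesis
        by (intro exI[of _ "1 + acost e + acost f + t"]) auto
    qed
  qed simp
  then obtain t where "t \<le> cost_bound c" "exec c s t (run c s)" by blast
  moreover have "t \<le> b" using calculation(1) assms(2) by simp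
  ultimately show ?thesis unfolding terminates_def using assms(3) by blast
qed

lemma terminates_Seq_loop_free:
  assumes "loop_free c" "terminates d b' Q (run c s)" "cost_bound c + b' \<le> b"
  shows "terminates (Seq c d) b Q s"
  by (rule terminates_Seq[where b\<^sub>1 = "cost_bound c" and b\<^sub>2 = b' and Q = "\<lambda>s'. s' = run c s"])
    (use assms in \<open>auto intro: terminates_loop_free\<close>)

lemma terminates_If:
  assumes "aval e s < aval f s \<Longrightarrow> terminates c b Q s" "\<not> aval e s < aval f s \<Longrightarrow> terminates d b Q s"
    and "1 + acost e + acost f + b \<le> B"
  shows "terminates (IfLess e f c d) B Q s"
proof (cases "aval e s < aval f s")
  case True
  with assms(1) obtain t s' where "exec c s t s'" "t \<le> b" "Q s'" by (auto simp: terminates_def)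
  moreover from this have "1 + acost e + acost f + t \<le> B" using assms(3) by simp
  ultimately show ?thesis unfolding terminates_def using exec.IfTrue[OF True] by blast
next
  case False
  with assms(2) obtain t s' where "exec d s t s'" "t \<le> b" "Q s'" by (auto simp: terminates_def)
  moreover from this have "1 + acost e + acost f + t \<le> B" using assms(3) by simp
  ultimately show ?thesis unfolding terminates_def using exec.IfFalse[OF False] by blast
qed

notation Seq (infixr \<open>;;\<close> 60)

lemma terminates_loop:
  fixes \<mu> :: "state \<Rightarrow> nat"
  assumes "loop_free c\<^sub>0" "I (run c\<^sub>0 s)"
    and "\<And>s'. I s' \<Longrightarrow> frame c (run c\<^sub>0 s) s' \<Longrightarrow> aval e s' < aval f s' \<Longrightarrow>
      terminates c b (\<lambda>s''. I s'' \<and> \<mu> s'' < \<mu> s') s'"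
    and "\<And>s'. I s' \<Longrightarrow> frame c (run c\<^sub>0 s) s' \<Longrightarrow> \<not> aval e s' < aval f s' \<Longrightarrow> Q s'"
    and "cost_bound c\<^sub>0 + (\<mu> (run c\<^sub>0 s) + 1) * (b + 1 + acost e + acost f) \<le> B"
  shows "terminates (c\<^sub>0 ;; WhileLess e f c) B Q s"
proof (rule terminates_Seq_loop_free[OF assms(1) _ assms(5)])
  have "terminates (WhileLess e f c) ((\<mu> (run c\<^sub>0 s) + 1) * (b + 1 + acost e + acost f))
    (\<lambda>s'. I s' \<and> \<not> aval e s' < aval f s') (run c\<^sub>0 s)"
    using assms(2,3) by (rule terminates_While)
  from terminates_frame[OF this]
  show "terminates (WhileLess e f c) ((\<mu> (run c\<^sub>0 s) + 1) * (b + 1 + acost e + acost f)) Q (run c\<^sub>0 s)"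
    by (rule terminates_mono) (use assms(4) in \<open>auto simp: frame_def\<close>)
qed

section \<open>Ranks and factorials\<close>

text \<open>
  Registers: \<open>rK\<close> number of distinct values, \<open>rN\<close> number \<open>(k + 1)!\<close> of codes, \<open>rT\<close> position in the
  input, \<open>rX\<close> current rank, \<open>rC\<close> and \<open>rC'\<close> codes of the current state and of its successor, \<open>rO\<close>
  offset of a row of the table, \<open>rM\<close> length of the output; \<open>rI\<close>, \<open>rJ\<close> and \<open>rP\<close> are temporary.
  Indexing \<open>aSeen\<close> by the values themselves detects repetitions in constant time.
\<close>

abbreviation (input) "rLen \<equiv> 0 :: nat"
abbreviation (input) "rK \<equiv> 3 :: nat"
abbreviation (input) "rT \<equiv> 4 :: nat"
abbreviation (input) "rI \<equiv> 5 :: nat"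
abbreviation (input) "rX \<equiv> 6 :: nat"
abbreviation (input) "rC \<equiv> 7 :: nat"
abbreviation (input) "rC' \<equiv> 8 :: nat"
abbreviation (input) "rN \<equiv> 9 :: nat"
abbreviation (input) "rO \<equiv> 10 :: nat"
abbreviation (input) "rM \<equiv> 11 :: nat"
abbreviation (input) "rP \<equiv> 12 :: nat"
abbreviation (input) "rJ \<equiv> 13 :: nat"

abbreviation (input) "aXs \<equiv> 0 :: nat"
abbreviation (input) "aVs \<equiv> 1 :: nat"
abbreviation (input) "aPs \<equiv> 2 :: nat"
abbreviation (input) "aIn \<equiv> 3 :: nat"
abbreviation (input) "aSeen \<equiv> 4 :: nat"
abbreviation (input) "aVal \<equiv> 5 :: nat"
abbreviation (input) "aRank \<equiv> 6 :: nat"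
abbreviation (input) "aFact \<equiv> 7 :: nat"
abbreviation (input) "aDig \<equiv> 8 :: nat"
abbreviation (input) "aTab \<equiv> 9 :: nat"
abbreviation (input) "aHead \<equiv> 10 :: nat"
abbreviation (input) "aNext \<equiv> 11 :: nat"
abbreviation (input) "aPar \<equiv> 12 :: nat"

abbreviation (input) "incr x e \<equiv> SetReg x (Add (Reg x) e)"


text \<open>Array 0 serves for both input and output, so the input is copied to \<open>aIn\<close>
  before the forward pass overwrites it.\<close>

definition collect_body :: com where
  "collect_body =
     SetArr aIn (Reg rT) (Arr aXs (Reg rT)) ;;
     IfLess (Arr aSeen (Arr aXs (Reg rT))) (Const 1)
       (SetArr aVal (Reg rK) (Arr aXs (Reg rT)) ;; SetArr aSeen (Arr aXs (Reg rT)) (Const 1) ;;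
        incr rK (Const 1))
       Skip ;;
     incr rT (Const 1)"

definition collect :: com where
  "collect = (SetReg rT (Const 0) ;; SetReg rK (Const 0)) ;; WhileLess (Reg rT) (Reg rLen) collect_body"

lemma collect_correct:
  assumes "fst s rLen = length \<tau>" "\<forall>i < length \<tau>. snd s aXs i = \<tau> ! i" "snd s aSeen = (\<lambda>_. 0)"
  shows "terminates collect (50 * (length \<tau> + 1)) (\<lambda>s'. (\<forall>i < length \<tau>. snd s' aIn i = \<tau> ! i) \<and>
    fst s' rK = card (set \<tau>) \<and> distinct (map (snd s' aVal) [0..<card (set \<tau>)]) \<and>
    set (map (snd s' aVal) [0..<card (set \<tau>)]) = set \<tau>) s"
proof -
  let ?I = "\<lambda>s. fst s rT \<le> length \<tau> \<and> (\<forall>i < fst s rT. snd s aIn i = \<tau> ! i) \<and>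
    distinct (map (snd s aVal) [0..<fst s rK]) \<and> set (map (snd s aVal) [0..<fst s rK]) = set (take (fst s rT) \<tau>) \<and>
    (\<forall>v. snd s aSeen v = (if v \<in> set (take (fst s rT) \<tau>) then 1 else 0))"
  let ?\<mu> = "\<lambda>s. length \<tau> - fst s rT"
  let ?s = "run (SetReg rT (Const 0) ;; SetReg rK (Const 0)) s"
  show ?thesis
    unfolding collect_def
  proof (rule terminates_loop[where I = ?I and \<mu> = ?\<mu> and b = 36])
    show "?I ?s" using assms by simp
  next
    fix s' assume I: "?I s'" and fr: "frame collect_body ?s s'" and lt: "aval (Reg rT) s' < aval (Reg rLen) s'"
    have f: "fst s' rLen = length \<tau>" "snd s' aXs = snd s aXs"
      using frame_reg[OF fr, of rLen] frame_arr[OF fr, of aXs] assms(1) by (auto simp: collect_body_def)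
    let ?t = "fst s' rT"
    have t: "?t < length \<tau>" using lt f by simp
    then have x: "snd s' aXs ?t = \<tau> ! ?t" using f assms by simp
    have tk: "set (take (Suc ?t) \<tau>) = insert (\<tau> ! ?t) (set (take ?t \<tau>))"
      using t by (simp add: take_Suc_conv_app_nth)
    show "terminates collect_body 36 (\<lambda>s''. ?I s'' \<and> ?\<mu> s'' < ?\<mu> s') s'"
      unfolding collect_body_def
      by (rule terminates_loop_free; use I t x tk in \<open>cases "\<tau> ! ?t \<in> set (take ?t \<tau>)"\<close>)
        (auto simp: less_Suc_eq)
  next
    fix s' assume I: "?I s'" and fr: "frame collect_body ?s s'" and lt: "\<not> aval (Reg rT) s' < aval (Reg rLen) s'"
    have "fst s' rLen = length \<tau>"
      using frame_reg[OF fr, of rLen] assms(1) by (auto simp: collect_body_def)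
    then have t: "fst s' rT = length \<tau>" using lt I by simp
    have "fst s' rK = card (set (map (snd s' aVal) [0..<fst s' rK]))"
      using I by (subst distinct_card) auto
    with I t have "fst s' rK = card (set \<tau>)" by simp
    then show "(\<forall>i < length \<tau>. snd s' aIn i = \<tau> ! i) \<and>
      fst s' rK = card (set \<tau>) \<and> distinct (map (snd s' aVal) [0..<card (set \<tau>)]) \<and>
      set (map (snd s' aVal) [0..<card (set \<tau>)]) = set \<tau>"
      using I t by simp
  qed auto
qed

text \<open>Each rank is found by comparing with all \<open>k\<close> distinct values, which avoids
  sorting at a cost of order \<open>n * k\<close>. Adding 1 on the right expresses \<le> by a strict
  comparison.\<close>

definition ranks_inner :: com where
  "ranks_inner =
     IfLess (Arr aVal (Reg rI)) (Add (Arr aIn (Reg rT)) (Const 1)) (incr rX (Const 1)) Skip ;;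
     incr rI (Const 1)"

definition rank_of :: com where
  "rank_of = (SetReg rX (Const 0) ;; SetReg rI (Const 0)) ;; WhileLess (Reg rI) (Reg rK) ranks_inner"

definition ranks_body :: com where
  "ranks_body = rank_of ;; SetArr aRank (Reg rT) (Reg rX) ;; incr rT (Const 1)"

definition ranks :: com where
  "ranks = SetReg rT (Const 0) ;; WhileLess (Reg rT) (Reg rLen) ranks_body"

lemma rank_of_correct:
  shows "terminates rank_of (30 * (fst s rK + 1)) (\<lambda>s'. fst s' rX =
    length (filter (\<lambda>v. v \<le> snd s aIn (fst s rT)) (map (snd s aVal) [0..<fst s rK]))) s"
proof -
  let ?I = "\<lambda>s'. fst s' rI \<le> fst s rK \<and> fst s' rX =
    length (filter (\<lambda>v. v \<le> snd s aIn (fst s rT)) (map (snd s aVal) [0..<fst s' rI]))"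
  show ?thesis
    unfolding rank_of_def
  proof (rule terminates_loop[where I = ?I and \<mu> = "\<lambda>s'. fst s rK - fst s' rI" and b = 16])
    fix s' assume I: "?I s'" and fr: "frame ranks_inner (run (SetReg rX (Const 0) ;; SetReg rI (Const 0)) s) s'"
    have [simp]: "snd s' = snd s" "fst s' rK = fst s rK" "fst s' rT = fst s rT"
      using frame_reg[OF fr] frame_arr[OF fr] by (auto simp: ranks_inner_def)
    { assume "aval (Reg rI) s' < aval (Reg rK) s'"
      then show "terminates ranks_inner 16 (\<lambda>s''. ?I s'' \<and> fst s rK - fst s'' rI < fst s rK - fst s' rI) s'"
        unfolding ranks_inner_def by (intro terminates_loop_free) (use I in auto) }
    { assume "\<not> aval (Reg rI) s' < aval (Reg rK) s'"
      then have "fst s' rI = fst s rK" using I by simp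
      then show "fst s' rX = length (filter (\<lambda>v. v \<le> snd s aIn (fst s rT)) (map (snd s aVal) [0..<fst s rK]))"
        using I by simp }
  qed auto
qed

lemma length_filter_le_eq_rank:
  assumes "distinct xs" "set xs = set \<tau>"
  shows "length (filter (\<lambda>v. v \<le> y) xs) = rank \<tau> y"
  using distinct_card[of "filter (\<lambda>v. v \<le> y) xs"] assms by (simp add: rank_def)

lemma ranks_correct:
  assumes "fst s rLen = length \<tau>" "\<forall>i < length \<tau>. snd s aIn i = \<tau> ! i" "fst s rK = card (set \<tau>)"
    "distinct (map (snd s aVal) [0..<card (set \<tau>)])" "set (map (snd s aVal) [0..<card (set \<tau>)]) = set \<tau>"
  shows "terminates ranks (60 * (length \<tau> + 1) * (card (set \<tau>) + 1))
    (\<lambda>s'. \<forall>i < length \<tau>. snd s' aRank i = rank \<tau> (\<tau> ! i)) s"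
proof -
  let ?I = "\<lambda>s'. fst s' rT \<le> length \<tau> \<and> (\<forall>i < fst s' rT. snd s' aRank i = rank \<tau> (\<tau> ! i))"
  let ?\<mu> = "\<lambda>s'. length \<tau> - fst s' rT"
  let ?k = "card (set \<tau>)"
  show ?thesis
    unfolding ranks_def
  proof (rule terminates_loop[where I = ?I and \<mu> = ?\<mu> and b = "30 * (?k + 1) + 20"])
    fix s' assume I: "?I s'" and fr: "frame ranks_body (run (SetReg rT (Const 0)) s) s'"
    have f: "snd s' aIn = snd s aIn" "snd s' aVal = snd s aVal" "fst s' rK = ?k" "fst s' rLen = length \<tau>"
      using frame_reg[OF fr] frame_arr[OF fr] assms
      by (auto simp: ranks_body_def rank_of_def ranks_inner_def)
    { assume "aval (Reg rT) s' < aval (Reg rLen) s'"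
      then have t: "fst s' rT < length \<tau>" using f by simp
      have r: "length (filter (\<lambda>v. v \<le> \<tau> ! fst s' rT) (map (snd s aVal) [0..<?k])) = rank \<tau> (\<tau> ! fst s' rT)"
        by (rule length_filter_le_eq_rank[OF assms(4,5)])
      show "terminates ranks_body (30 * (?k + 1) + 20) (\<lambda>s''. ?I s'' \<and> ?\<mu> s'' < ?\<mu> s') s'"
        unfolding ranks_body_def
      proof (rule terminates_Seq[OF rank_of_correct])
        fix s1 assume x: "fst s1 rX =
            length (filter (\<lambda>v. v \<le> snd s' aIn (fst s' rT)) (map (snd s' aVal) [0..<fst s' rK]))"
          and fr: "frame rank_of s' s1"
        have f1: "fst s1 rT = fst s' rT" "snd s1 = snd s'"
          using frame_reg[OF fr] frame_arr[OF fr] by (auto simp: rank_of_def ranks_inner_def)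
        have "fst s1 rX = rank \<tau> (\<tau> ! fst s' rT)" using x r f t assms(2) by simp
        then show "terminates (SetArr aRank (Reg rT) (Reg rX) ;; incr rT (Const 1)) 20
          (\<lambda>s''. ?I s'' \<and> ?\<mu> s'' < ?\<mu> s') s1"
          by (intro terminates_loop_free) (use I t f1 in \<open>auto simp: less_Suc_eq\<close>)
      qed (use f in simp) }
    { assume "\<not> aval (Reg rT) s' < aval (Reg rLen) s'"
      then show "\<forall>i < length \<tau>. snd s' aRank i = rank \<tau> (\<tau> ! i)" using I f by auto }
  qed (auto simp: algebra_simps)
qed

text \<open>With no multiplication, \<open>(i + 1)!\<close> is summed up from \<open>i + 1\<close>
  copies of \<open>i!\<close>. The total cost is quadratic in \<open>k\<close>, which is harmless
  because \<open>k \<le> n\<close>.\<close>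

definition factorials_inner :: com where
  "factorials_inner = incr rC (Arr aFact (Reg rI)) ;; incr rJ (Const 1)"

definition next_factorial :: com where
  "next_factorial = (SetReg rC (Const 0) ;; SetReg rJ (Const 0)) ;;
     WhileLess (Reg rJ) (Add (Reg rI) (Const 1)) factorials_inner"

definition factorials_body :: com where
  "factorials_body = next_factorial ;; SetArr aFact (Add (Reg rI) (Const 1)) (Reg rC) ;; incr rI (Const 1)"

definition factorials :: com where
  "factorials = ((SetArr aFact (Const 0) (Const 1) ;; SetReg rI (Const 0)) ;;
     WhileLess (Reg rI) (Add (Reg rK) (Const 1)) factorials_body) ;;
     SetReg rN (Arr aFact (Add (Reg rK) (Const 1)))"

lemma next_factorial_correct:
  "terminates next_factorial (20 * (fst s rI + 2)) (\<lambda>s'. fst s' rC = Suc (fst s rI) * snd s aFact (fst s rI)) s"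
proof -
  let ?I = "\<lambda>s'. fst s' rJ \<le> Suc (fst s rI) \<and> fst s' rC = fst s' rJ * snd s aFact (fst s rI)"
  show ?thesis
    unfolding next_factorial_def
  proof (rule terminates_loop[where I = ?I and \<mu> = "\<lambda>s'. Suc (fst s rI) - fst s' rJ" and b = 10])
    fix s' assume I: "?I s'" and fr: "frame factorials_inner (run (SetReg rC (Const 0) ;; SetReg rJ (Const 0)) s) s'"
    have [simp]: "snd s' = snd s" "fst s' rI = fst s rI"
      using frame_reg[OF fr] frame_arr[OF fr] by (auto simp: factorials_inner_def)
    { assume "aval (Reg rJ) s' < aval (Add (Reg rI) (Const 1)) s'"
      then show "terminates factorials_inner 10 (\<lambda>s''. ?I s'' \<and> Suc (fst s rI) - fst s'' rJ < Suc (fst s rI) - fst s' rJ) s'"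
        unfolding factorials_inner_def by (intro terminates_loop_free) (use I in auto) }
    { assume "\<not> aval (Reg rJ) s' < aval (Add (Reg rI) (Const 1)) s'"
      then have "fst s' rJ = Suc (fst s rI)" using I by simp
      then show "fst s' rC = Suc (fst s rI) * snd s aFact (fst s rI)" using I by simp }
  qed auto
qed

lemma factorials_correct:
  "terminates factorials (100 * ((fst s rK + 3) * (fst s rK + 3)))
    (\<lambda>s'. (\<forall>m \<le> fst s rK + 1. snd s' aFact m = fact m) \<and> fst s' rN = fact (fst s rK + 1)) s"
proof -
  let ?k = "fst s rK"
  let ?I = "\<lambda>s'. fst s' rI \<le> ?k + 1 \<and> (\<forall>m \<le> fst s' rI. snd s' aFact m = fact m)"
  let ?\<mu> = "\<lambda>s'. ?k + 1 - fst s' rI"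
  have "terminates ((SetArr aFact (Const 0) (Const 1) ;; SetReg rI (Const 0)) ;;
     WhileLess (Reg rI) (Add (Reg rK) (Const 1)) factorials_body) (50 * ((?k + 3) * (?k + 3)))
     (\<lambda>s'. \<forall>m \<le> ?k + 1. snd s' aFact m = fact m) s"
  proof (rule terminates_loop[where I = ?I and \<mu> = ?\<mu> and b = "20 * (?k + 3) + 20"])
    fix s' assume I: "?I s'" and fr: "frame factorials_body (run (SetArr aFact (Const 0) (Const 1) ;; SetReg rI (Const 0)) s) s'"
    have f: "fst s' rK = ?k"
      using frame_reg[OF fr] by (auto simp: factorials_body_def next_factorial_def factorials_inner_def)
    { assume "aval (Reg rI) s' < aval (Add (Reg rK) (Const 1)) s'"
      then have i: "fst s' rI < ?k + 1" using f by simp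
      show "terminates factorials_body (20 * (?k + 3) + 20) (\<lambda>s''. ?I s'' \<and> ?\<mu> s'' < ?\<mu> s') s'"
        unfolding factorials_body_def
      proof (rule terminates_Seq[OF next_factorial_correct])
        fix s1 assume c: "fst s1 rC = Suc (fst s' rI) * snd s' aFact (fst s' rI)" and fr: "frame next_factorial s' s1"
        have f1: "fst s1 rI = fst s' rI" "snd s1 = snd s'"
          using frame_reg[OF fr] frame_arr[OF fr] by (auto simp: next_factorial_def factorials_inner_def)
        show "terminates (SetArr aFact (Add (Reg rI) (Const 1)) (Reg rC) ;; incr rI (Const 1)) 20
          (\<lambda>s''. ?I s'' \<and> ?\<mu> s'' < ?\<mu> s') s1"
          by (intro terminates_loop_free) (use I i c f1 in \<open>auto simp: le_Suc_eq\<close>)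
      qed (use i in simp) }
    { assume "\<not> aval (Reg rI) s' < aval (Add (Reg rK) (Const 1)) s'"
      then have "fst s' rI = ?k + 1" using I f by simp
      then show "\<forall>m \<le> ?k + 1. snd s' aFact m = fact m" using I by simp }
  qed (auto simp: algebra_simps)
  then show ?thesis
    unfolding factorials_def
  proof (rule terminates_Seq[where b\<^sub>2 = 5])
    fix s' assume W: "\<forall>m \<le> ?k + 1. snd s' aFact m = fact m"
      and fr: "frame ((SetArr aFact (Const 0) (Const 1) ;; SetReg rI (Const 0)) ;;
         WhileLess (Reg rI) (Add (Reg rK) (Const 1)) factorials_body) s s'"
    have f: "fst s' rK = ?k"
      using frame_reg[OF fr] by (auto simp: factorials_body_def next_factorial_def factorials_inner_def)
    show "terminates (SetReg rN (Arr aFact (Add (Reg rK) (Const 1)))) 5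
      (\<lambda>s'. (\<forall>m \<le> ?k + 1. snd s' aFact m = fact m) \<and> fst s' rN = fact (?k + 1)) s'"
      by (intro terminates_loop_free) (use W f in auto)
  qed simp
qed

section \<open>The table of optimal values\<close>

text \<open>States are numbered in the factorial number system, the digit \<open>m\<close> having weight \<open>m!\<close>.\<close>

definition code :: "nat \<Rightarrow> (nat \<Rightarrow> nat) \<Rightarrow> nat" where
  "code k d = (\<Sum>m = 1..k. d m * fact m)"

lemma code_Suc: "code (Suc k) d = code k d + d (Suc k) * fact (Suc k)"
  by (simp add: code_def)

text \<open>The extreme case is \<open>1 * 1! + ... + k * k! = (k + 1)! - 1\<close>, which makes a
  table row exactly \<open>(k + 1)!\<close> wide.\<close>

lemma code_less: "\<forall>m \<in> {1..k}. d m \<le> m \<Longrightarrow> code k d < fact (Suc k)"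
proof (induction k)
  case (Suc k)
  then have "code k d < fact (Suc k)" by simp
  moreover have "d (Suc k) * fact (Suc k) \<le> Suc k * fact (Suc k)"
    using Suc.prems by (intro mult_right_mono) auto
  ultimately show ?case unfolding code_Suc by (simp add: algebra_simps)
qed (simp add: code_def)

text \<open>The lower digits together stay below the weight of the top digit, so the remainder
  modulo that weight isolates them.\<close>

lemma code_inj:
  assumes "\<forall>m \<in> {1..k}. d m \<le> m" "\<forall>m \<in> {1..k}. d' m \<le> m" "code k d = code k d'"
  shows "\<forall>m \<in> {1..k}. d m = d' m"
  using assms
proof (induction k)
  case (Suc k)
  have l: "code k d < fact (Suc k)" "code k d' < fact (Suc k)"
    using Suc.prems by (auto intro!: code_less simp del: fact_Suc)
  have eq: "code k d + d (Suc k) * fact (Suc k) = code k d' + d' (Suc k) * fact (Suc k)"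
    using Suc.prems(3) by (simp only: code_Suc)
  have "code k d = code k d'" using arg_cong[OF eq, of "\<lambda>n. n mod fact (Suc k)"] l
    by (simp only: mod_mult_self1 mod_less)
  moreover from this eq have "d (Suc k) = d' (Suc k)" by (simp del: fact_Suc)
  moreover have "\<forall>m \<in> {1..k}. d m = d' m"
    using Suc.prems(1,2) \<open>code k d = code k d'\<close> by (intro Suc.IH) auto
  ultimately show ?case by (simp add: atLeastAtMostSuc_conv)
qed simp

lemma code_cong: "\<forall>m \<in> {1..k}. d m = d' m \<Longrightarrow> code k d = code k d'"
  unfolding code_def by (intro sum.cong) auto

text \<open>Stated as a balance of sums because subtraction on natural numbers truncates.\<close>

lemma code_fun_upd:
  assumes "i \<in> {1..k}"
  shows "code k (d(i := y)) + d i * fact i = code k d + y * fact i"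
proof -
  have "code k d' = d' i * fact i + (\<Sum>m \<in> {1..k} - {i}. d' m * fact m)" for d'
    unfolding code_def using assms by (intro sum.remove) auto
  from this[of d] this[of "d(i := y)"] show ?thesis by simp
qed

lemma upd_valid: "\<forall>m \<in> {1..k}. d m \<le> m \<Longrightarrow> \<forall>m \<in> {1..k}. upd x d m \<le> m"
  by (auto simp: upd_def intro: diff_le_self order.trans)

section \<open>Digit arrays and transitions between states\<close>

definition init_digits_body :: "nat \<Rightarrow> aexp \<Rightarrow> com" where
  "init_digits_body v e = SetArr aDig (Reg rI) (Const v) ;; incr rC e ;; incr rI (Const 1)"

text \<open>The expression \<open>e\<close> stands for \<open>v\<close> times the current weight; in
  place of a product it is supplied as \<open>Const 0\<close> for \<open>v = 0\<close> and as the
  stored factorial for \<open>v = 1\<close>. The extra digit \<open>k + 1\<close> is a stop mark for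
  the odometer.\<close>

definition init_digits :: "nat \<Rightarrow> aexp \<Rightarrow> com" where
  "init_digits v e = (SetArr aDig (Add (Reg rK) (Const 1)) (Const 0) ;; SetReg rC (Const 0) ;; SetReg rI (Const 1)) ;;
     WhileLess (Reg rI) (Add (Reg rK) (Const 1)) (init_digits_body v e)"

lemma init_digits_correct:
  assumes e: "\<And>s'. aval e s' = v * snd s' aFact (fst s' rI)" "acost e \<le> 2"
    and W: "\<forall>m \<le> fst s rK + 1. snd s aFact m = fact m"
  shows "terminates (init_digits v e) (40 * (fst s rK + 1)) (\<lambda>s'. (\<forall>m \<in> {1..fst s rK}. snd s' aDig m = v) \<and>
    snd s' aDig (fst s rK + 1) = 0 \<and> fst s' rC = code (fst s rK) (\<lambda>_. v)) s"
proof -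
  let ?k = "fst s rK"
  let ?I = "\<lambda>s'. 1 \<le> fst s' rI \<and> fst s' rI \<le> ?k + 1 \<and> (\<forall>m \<in> {1..<fst s' rI}. snd s' aDig m = v) \<and>
    snd s' aDig (?k + 1) = 0 \<and> fst s' rC = (\<Sum>m \<in> {1..<fst s' rI}. v * fact m)"
  let ?\<mu> = "\<lambda>s'. ?k + 1 - fst s' rI"
  show ?thesis
    unfolding init_digits_def
  proof (rule terminates_loop[where I = ?I and \<mu> = ?\<mu> and b = 16])
    fix s' assume I: "?I s'" and fr: "frame (init_digits_body v e)
      (run (SetArr aDig (Add (Reg rK) (Const 1)) (Const 0) ;; SetReg rC (Const 0) ;; SetReg rI (Const 1)) s) s'"
    have f: "fst s' rK = ?k" "snd s' aFact = snd s aFact"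
      using frame_reg[OF fr] frame_arr[OF fr] by (auto simp: init_digits_body_def)
    { assume "aval (Reg rI) s' < aval (Add (Reg rK) (Const 1)) s'"
      then show "terminates (init_digits_body v e) 16 (\<lambda>s''. ?I s'' \<and> ?\<mu> s'' < ?\<mu> s') s'"
        unfolding init_digits_body_def
        by (intro terminates_loop_free) (use I e f W in \<open>auto simp: atLeastLessThanSuc\<close>) }
    { assume "\<not> aval (Reg rI) s' < aval (Add (Reg rK) (Const 1)) s'"
      then have "fst s' rI = ?k + 1" using I f by simp
      then show "(\<forall>m \<in> {1..?k}. snd s' aDig m = v) \<and> snd s' aDig (?k + 1) = 0 \<and>
        fst s' rC = code ?k (\<lambda>_. v)" using I
        by (auto simp: code_def atLeastLessThanSuc_atLeastAtMost simp del: sum.op_ivl_Suc) }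
  qed auto
qed

definition new_code_body :: com where
  "new_code_body =
     IfLess (Reg rI) (Reg rX)
       (IfLess (Arr aDig (Reg rI)) (Arr aDig (Reg rX)) Skip (SetReg rC' (Sub (Reg rC') (Arr aFact (Reg rI)))))
       (IfLess (Arr aDig (Reg rI)) (Reg rI) (incr rC' (Arr aFact (Reg rI))) Skip) ;;
     incr rI (Const 1)"

definition new_code :: com where
  "new_code = (SetReg rC' (Reg rC) ;; SetReg rI (Const 1)) ;;
     WhileLess (Reg rI) (Add (Reg rK) (Const 1)) new_code_body"

text \<open>A digit to be decremented is at least the digit at \<open>x\<close>, so if the latter is
  positive, subtracting the weight is exact. If it is 0, \<open>upd\<close> leaves a zero digit
  alone while the program still subtracts its weight, so nothing is claimed then.\<close>

lemma new_code_correct: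
  assumes W: "\<forall>m \<le> fst s rK + 1. snd s aFact m = fact m" and c: "fst s rC = code (fst s rK) (snd s aDig)"
  shows "terminates new_code (40 * (fst s rK + 1)) (\<lambda>s'. 0 < snd s aDig (fst s rX) \<longrightarrow>
    fst s' rC' = code (fst s rK) (upd (fst s rX) (snd s aDig))) s"
proof -
  let ?k = "fst s rK" and ?x = "fst s rX" and ?d = "snd s aDig"
  let ?I = "\<lambda>s'. 1 \<le> fst s' rI \<and> fst s' rI \<le> ?k + 1 \<and> (0 < ?d ?x \<longrightarrow> fst s' rC' =
    (\<Sum>m \<in> {1..<fst s' rI}. upd ?x ?d m * fact m) + (\<Sum>m \<in> {fst s' rI..<?k + 1}. ?d m * fact m))"
  let ?\<mu> = "\<lambda>s'. ?k + 1 - fst s' rI"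
  have int: "{1..<?k + 1} = {1..?k}" by auto
  show ?thesis
    unfolding new_code_def
  proof (rule terminates_loop[where I = ?I and \<mu> = ?\<mu> and b = 24])
    show "?I (run (SetReg rC' (Reg rC) ;; SetReg rI (Const 1)) s)"
      using c int by (simp add: code_def)
    fix s' assume I: "?I s'" and fr: "frame new_code_body (run (SetReg rC' (Reg rC) ;; SetReg rI (Const 1)) s) s'"
    have f: "fst s' rK = ?k" "fst s' rX = ?x" "snd s' = snd s"
      using frame_reg[OF fr] frame_arr[OF fr] by (auto simp: new_code_body_def)
    { assume "aval (Reg rI) s' < aval (Add (Reg rK) (Const 1)) s'"
      then have i: "fst s' rI < ?k + 1" using f by simp
      let ?i = "fst s' rI"
      have w: "snd s aFact ?i = fact ?i" using W i by simp
      have s1: "(\<Sum>m \<in> {1..<Suc ?i}. g m) = (\<Sum>m \<in> {1..<?i}. g m) + g ?i" for g :: "nat \<Rightarrow> nat"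
        using I by simp
      have s2: "(\<Sum>m \<in> {?i..<?k + 1}. g m) = g ?i + (\<Sum>m \<in> {Suc ?i..<?k + 1}. g m)" for g :: "nat \<Rightarrow> nat"
        using i by (rule sum.atLeast_Suc_lessThan)
      have u: "(if ?i < ?x then if ?d ?i < ?d ?x then c' else c' - fact ?i
          else if ?d ?i < ?i then c' + fact ?i else c') =
          a + upd ?x ?d ?i * fact ?i + b"
        if "c' = a + (?d ?i * fact ?i + b)" "0 < ?d ?x" for a b c' :: nat
        using that by (cases "?d ?i") (auto simp: upd_def)
      show "terminates new_code_body 24 (\<lambda>s''. ?I s'' \<and> ?\<mu> s'' < ?\<mu> s') s'"
        unfolding new_code_body_def
      proof (rule terminates_loop_free)
        let ?r = "run (IfLess (Reg rI) (Reg rX)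
           (IfLess (Arr aDig (Reg rI)) (Arr aDig (Reg rX)) Skip (SetReg rC' (Sub (Reg rC') (Arr aFact (Reg rI)))))
           (IfLess (Arr aDig (Reg rI)) (Reg rI) (incr rC' (Arr aFact (Reg rI))) Skip) ;;
           incr rI (Const 1)) s'"
        have ri: "fst ?r rI = Suc ?i" using f by simp
        have rc: "fst ?r rC' = (if ?i < ?x then if ?d ?i < ?d ?x then fst s' rC' else fst s' rC' - fact ?i
          else if ?d ?i < ?i then fst s' rC' + fact ?i else fst s' rC')" using f w by simp
        show "?I ?r \<and> ?\<mu> ?r < ?\<mu> s'"
          unfolding ri rc s1 using I u s2[of "\<lambda>m. ?d m * fact m"] i by auto
      qed auto }
    { assume "\<not> aval (Reg rI) s' < aval (Add (Reg rK) (Const 1)) s'"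
      then have "fst s' rI = ?k + 1" using I f by simp
      then show "0 < ?d ?x \<longrightarrow> fst s' rC' = code ?k (upd ?x ?d)"
        using I unfolding code_def int[symmetric] by simp }
  qed auto
qed

text \<open>
  Resetting the maximal digit \<open>i\<close> of weight \<open>i!\<close> to zero turns a pending increment by \<open>i!\<close> into one
  by \<open>(i + 1)!\<close>.
\<close>

definition odometer_body :: com where
  "odometer_body = SetArr aDig (Reg rI) (Const 0) ;; incr rI (Const 1)"

definition odometer :: com where
  "odometer = (SetReg rI (Const 1) ;; WhileLess (Reg rI) (Add (Arr aDig (Reg rI)) (Const 1)) odometer_body) ;;
     SetArr aDig (Reg rI) (Add (Arr aDig (Reg rI)) (Const 1))"

lemma odometer_correct:
  assumes d: "\<forall>m \<in> {1..k}. snd s aDig m \<le> m" "snd s aDig (k + 1) = 0"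
  shows "terminates odometer (40 * (k + 1)) (\<lambda>s'. (\<forall>m \<in> {1..k + 1}. snd s' aDig m \<le> m) \<and>
    code (k + 1) (snd s' aDig) = code (k + 1) (snd s aDig) + 1) s"
proof -
  let ?I = "\<lambda>s'. fst s' rI \<in> {1..k + 1} \<and> (\<forall>m \<in> {1..k}. snd s' aDig m \<le> m) \<and> snd s' aDig (k + 1) = 0 \<and>
    code (k + 1) (snd s' aDig) + fact (fst s' rI) = code (k + 1) (snd s aDig) + 1"
  let ?\<mu> = "\<lambda>s'. k + 1 - fst s' rI"
  let ?Q = "\<lambda>s'. ?I s' \<and> snd s' aDig (fst s' rI) < fst s' rI"
  have "terminates (SetReg rI (Const 1) ;; WhileLess (Reg rI) (Add (Arr aDig (Reg rI)) (Const 1)) odometer_body)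
    (20 * (k + 1)) ?Q s"
  proof (rule terminates_loop[where I = ?I and \<mu> = ?\<mu> and b = 9])
    show "?I (run (SetReg rI (Const 1)) s)" using d by simp
    fix s' assume I: "?I s'"
    { assume "aval (Reg rI) s' < aval (Add (Arr aDig (Reg rI)) (Const 1)) s'"
      then have "fst s' rI \<le> snd s' aDig (fst s' rI)" by simp
      \<comment> \<open>The stop mark at work: digit \<open>k + 1\<close> is 0 and hence not
        maximal, so the loop never runs past it.\<close>
      moreover have ne: "fst s' rI \<noteq> k + 1" using calculation I by auto
      moreover have "snd s' aDig (fst s' rI) \<le> fst s' rI" using I ne by auto
      ultimately have eq: "snd s' aDig (fst s' rI) = fst s' rI" by simp
      have i: "fst s' rI \<in> {1..k + 1}" using I by simp
      have "code (k + 1) ((snd s' aDig)(fst s' rI := 0)) + fact (Suc (fst s' rI)) =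
        code (k + 1) (snd s' aDig) + fact (fst s' rI)"
        using code_fun_upd[OF i, of "snd s' aDig" 0] eq by (simp add: algebra_simps)
      then have "code (k + 1) ((snd s' aDig)(fst s' rI := 0)) + fact (Suc (fst s' rI)) =
        code (k + 1) (snd s aDig) + 1" using I by simp
      then show "terminates odometer_body 9 (\<lambda>s''. ?I s'' \<and> ?\<mu> s'' < ?\<mu> s') s'"
        unfolding odometer_body_def
        by (intro terminates_loop_free) (use I ne in \<open>auto simp del: fact_Suc\<close>) }
    { assume "\<not> aval (Reg rI) s' < aval (Add (Arr aDig (Reg rI)) (Const 1)) s'"
      then show "?Q s'" using I by simp }
  qed auto
  then show ?thesis
    unfolding odometer_def
  proof (rule terminates_Seq[where b\<^sub>2 = 10])
    fix s' assume Q: "?Q s'"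
    then have i: "fst s' rI \<in> {1..k + 1}" by simp
    let ?d = "(snd s' aDig)(fst s' rI := Suc (snd s' aDig (fst s' rI)))"
    have "code (k + 1) ?d = code (k + 1) (snd s aDig) + 1"
      using code_fun_upd[OF i, of "snd s' aDig" "Suc (snd s' aDig (fst s' rI))"] Q by (simp add: algebra_simps)
    moreover have "\<forall>m \<in> {1..k + 1}. ?d m \<le> m"
    proof
      fix m assume m: "m \<in> {1..k + 1}"
      show "?d m \<le> m"
      proof (cases "m = k + 1")
        case True
        then show ?thesis using Q by auto
      next
        case False
        then have "m \<in> {1..k}" using m by auto
        then show ?thesis using Q by auto
      qed
    qed
    ultimately show "terminates (SetArr aDig (Reg rI) (Add (Arr aDig (Reg rI)) (Const 1))) 10
      (\<lambda>s'. (\<forall>m \<in> {1..k + 1}. snd s' aDig m \<le> m) \<and> code (k + 1) (snd s' aDig) = code (k + 1) (snd s aDig) + 1) s'"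
      by (intro terminates_loop_free) (simp_all)
  qed simp
qed

text \<open>
  Row \<open>u\<close> of the table starts at \<open>u * (k + 1)!\<close> and contains the optimum for the last \<open>u\<close> elements
  from every state.
\<close>

definition row_body :: com where
  "row_body =
     new_code ;;
     (SetArr aTab (Add (Add (Reg rO) (Reg rN)) (Reg rC)) (Arr aTab (Add (Reg rO) (Reg rC))) ;;
      IfLess (Const 0) (Arr aDig (Reg rX))
        (IfLess (Arr aTab (Add (Reg rO) (Reg rC))) (Add (Arr aTab (Add (Reg rO) (Reg rC'))) (Const 1))
          (SetArr aTab (Add (Add (Reg rO) (Reg rN)) (Reg rC)) (Add (Arr aTab (Add (Reg rO) (Reg rC'))) (Const 1)))
          Skip)
        Skip) ;;
     odometer ;; incr rC (Const 1)"

definition row :: com where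
  "row = Skip ;; WhileLess (Reg rC) (Reg rN) row_body"

lemma row_correct:
  assumes W: "\<forall>m \<le> fst s rK + 1. snd s aFact m = fact m" and N: "fst s rN = fact (fst s rK + 1)"
    and c: "fst s rC = 0" and x: "fst s rX \<in> {1..fst s rK}" and xs: "set xs \<subseteq> {1..fst s rK}"
    and d: "\<forall>m \<in> {1..fst s rK + 1}. snd s aDig m = 0"
    and V: "\<And>d. \<forall>m \<in> {1..fst s rK}. d m \<le> m \<Longrightarrow> snd s aTab (fst s rO + code (fst s rK) d) = best xs d"
  shows "terminates row (300 * (fst s rK + 1) * fact (fst s rK + 1)) (\<lambda>s'.
    (\<forall>a < fst s rO + fst s rN. snd s' aTab a = snd s aTab a) \<and>
    (\<forall>d. (\<forall>m \<in> {1..fst s rK}. d m \<le> m) \<longrightarrow>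
      snd s' aTab (fst s rO + fst s rN + code (fst s rK) d) = best (fst s rX # xs) d)) s"
proof -
  let ?k = "fst s rK" and ?x = "fst s rX" and ?o = "fst s rO" and ?N = "fst s rN"
  let ?valid = "\<lambda>d. \<forall>m \<in> {1..?k}. d m \<le> m"
  let ?I = "\<lambda>s'. fst s' rC \<le> ?N \<and> code (?k + 1) (snd s' aDig) = fst s' rC \<and>
    (\<forall>m \<in> {1..?k + 1}. snd s' aDig m \<le> m) \<and> (\<forall>a < ?o + ?N. snd s' aTab a = snd s aTab a) \<and>
    (\<forall>d. ?valid d \<longrightarrow> code ?k d < fst s' rC \<longrightarrow> snd s' aTab (?o + ?N + code ?k d) = best (?x # xs) d)"
  let ?\<mu> = "\<lambda>s'. ?N - fst s' rC"
  show ?thesis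
    unfolding row_def
  proof (rule terminates_loop[where I = ?I and \<mu> = ?\<mu> and b = "80 * (?k + 1) + 50"])
    show "?I (run Skip s)" using d c by (simp add: code_def)
    fix s' assume I: "?I s'" and fr: "frame row_body (run Skip s) s'"
    have f: "fst s' rK = ?k" "fst s' rX = ?x" "fst s' rO = ?o" "fst s' rN = ?N" "snd s' aFact = snd s aFact"
      using frame_reg[OF fr] frame_arr[OF fr]
      by (auto simp: row_body_def new_code_def new_code_body_def odometer_def odometer_body_def)
    let ?d = "snd s' aDig" and ?c = "fst s' rC"
    { assume "aval (Reg rC) s' < aval (Reg rN) s'"
      then have cN: "?c < ?N" using f by simp
      \<comment> \<open>Digit \<open>k + 1\<close> has weight \<open>N\<close>, so it is 0 as long
        as the counter is below \<open>N\<close>: the odometer has not overflowed yet.\<close>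
      have "code ?k ?d + ?d (?k + 1) * ?N = ?c" using I N code_Suc[of ?k ?d] by simp
      then have "?d (?k + 1) * ?N < 1 * ?N" using cN by linarith
      then have dk: "?d (?k + 1) = 0" by (simp only: mult_less_cancel2 less_one)
      have ck: "code ?k ?d = ?c" using \<open>code ?k ?d + ?d (?k + 1) * ?N = ?c\<close> dk by simp
      have vd: "?valid ?d" using I by auto
      have vu: "?valid (upd ?x ?d)" using upd_valid[OF vd] .
      show "terminates row_body (80 * (?k + 1) + 50) (\<lambda>s''. ?I s'' \<and> ?\<mu> s'' < ?\<mu> s') s'"
        unfolding row_body_def
      proof (rule terminates_Seq[OF new_code_correct])
        show "\<forall>m \<le> fst s' rK + 1. snd s' aFact m = fact m" using W f by simp
        show "?c = code (fst s' rK) ?d" using ck f by simp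
        show "40 * (fst s' rK + 1) + (40 * (?k + 1) + 50) \<le> 80 * (?k + 1) + 50" using f by simp
        fix s1 assume c': "0 < ?d (fst s' rX) \<longrightarrow> fst s1 rC' = code (fst s' rK) (upd (fst s' rX) ?d)"
          and fr: "frame new_code s' s1"
        have f1: "fst s1 rK = ?k" "fst s1 rX = ?x" "fst s1 rO = ?o" "fst s1 rN = ?N" "snd s1 = snd s'" "fst s1 rC = ?c"
          using frame_reg[OF fr] frame_arr[OF fr] f by (auto simp: new_code_def new_code_body_def)
        let ?T = "snd s' aTab"
        \<comment> \<open>The previous row occupies addresses below \<open>o + N\<close>, which the
          writing of the new row leaves untouched.\<close>
        have T1: "?T (?o + ?c) = best xs ?d"
          using I V[OF vd] cN ck by simp
        have T2: "?T (?o + fst s1 rC') = best xs (upd ?x ?d)" if "0 < ?d ?x"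
        proof -
          have "code ?k (upd ?x ?d) < ?N" using code_less[OF vu] N by simp
          then show ?thesis using I V[OF vu] c' f that by simp
        qed
        let ?body = "SetArr aTab (Add (Add (Reg rO) (Reg rN)) (Reg rC)) (Arr aTab (Add (Reg rO) (Reg rC))) ;;
          IfLess (Const 0) (Arr aDig (Reg rX))
            (IfLess (Arr aTab (Add (Reg rO) (Reg rC))) (Add (Arr aTab (Add (Reg rO) (Reg rC'))) (Const 1))
              (SetArr aTab (Add (Add (Reg rO) (Reg rN)) (Reg rC)) (Add (Arr aTab (Add (Reg rO) (Reg rC'))) (Const 1)))
              Skip)
            Skip"
        have Npos: "0 < ?N" using N by simp
        have c'N: "fst s1 rC' < ?N" if "0 < ?d ?x" using code_less[OF vu] N c' f that by simp
        have r: "fst (run ?body s1) = fst s1" "snd (run ?body s1) aDig = ?d"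
          "snd (run ?body s1) aTab = ?T(?o + ?N + ?c := best (?x # xs) ?d)"
          using T1 T2 f1 Npos c'N by (auto simp: fun_eq_iff)
        show "terminates (?body ;; odometer ;; incr rC (Const 1)) (40 * (?k + 1) + 50)
          (\<lambda>s''. ?I s'' \<and> ?\<mu> s'' < ?\<mu> s') s1"
        proof (rule terminates_Seq_loop_free)
          show "terminates (odometer ;; incr rC (Const 1)) (40 * (?k + 1) + 5)
            (\<lambda>s''. ?I s'' \<and> ?\<mu> s'' < ?\<mu> s') (run ?body s1)"
          proof (rule terminates_Seq[OF odometer_correct])
            show "\<forall>m \<in> {1..?k}. snd (run ?body s1) aDig m \<le> m" using vd r by simp
            show "snd (run ?body s1) aDig (?k + 1) = 0" using dk r by simp
            fix s2 assume D: "(\<forall>m \<in> {1..?k + 1}. snd s2 aDig m \<le> m) \<and>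
                code (?k + 1) (snd s2 aDig) = code (?k + 1) (snd (run ?body s1) aDig) + 1"
              and fr: "frame odometer (run ?body s1) s2"
            have f2: "fst s2 rC = ?c" "snd s2 aTab = ?T(?o + ?N + ?c := best (?x # xs) ?d)"
              using frame_reg[OF fr, of rC] frame_arr[OF fr, of aTab] r f1
              by (auto simp: odometer_def odometer_body_def simp del: run.simps)
            \<comment> \<open>A code fixes a state only on \<open>1, ..., k\<close>, and that is all
              \<open>best\<close> looks at.\<close>
            have "best (?x # xs) d = best (?x # xs) ?d" if "?valid d" "code ?k d = ?c" for d
              using code_inj[OF that(1) vd] that(2) ck x xs by (intro best_cong[where k = ?k]) auto
            then have "?valid d \<Longrightarrow> code ?k d < Suc ?c \<Longrightarrow> snd s2 aTab (?o + ?N + code ?k d) = best (?x # xs) d" for d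
              using I f2 by (auto simp: less_Suc_eq simp del: best.simps)
            moreover have "\<forall>a < ?o + ?N. snd s2 aTab a = snd s aTab a" using I f2 by simp
            moreover have "code (?k + 1) (snd s2 aDig) = Suc ?c" using D I r by (simp del: run.simps)
            ultimately show "terminates (incr rC (Const 1)) 5 (\<lambda>s''. ?I s'' \<and> ?\<mu> s'' < ?\<mu> s') s2"
              by (intro terminates_loop_free) (use D f2 cN in \<open>auto simp del: best.simps\<close>)
          qed simp
        qed auto
      qed }
    { assume "\<not> aval (Reg rC) s' < aval (Reg rN) s'"
      then have "fst s' rC = ?N" using I f by simp
      then show "(\<forall>a < ?o + ?N. snd s' aTab a = snd s aTab a) \<and>
        (\<forall>d. ?valid d \<longrightarrow> snd s' aTab (?o + ?N + code ?k d) = best (?x # xs) d)"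
        using I code_less N by simp }
  next
    have "(fact (?k + 1) :: nat) \<ge> 1" by (rule fact_ge_1)
    \<comment> \<open>\<open>80 * (k + 1) + 53\<close> is at most \<open>133 * (k + 1)\<close>, and
      \<open>(k + 1)! + 1\<close> is at most twice \<open>(k + 1)!\<close>. This gives a factor 266;
      300 leaves room for the initial step.\<close>
    then have "1 + (fact (?k + 1) + 1) * (80 * (?k + 1) + 53) \<le> 1 + (2 * fact (?k + 1)) * (133 * (?k + 1))"
      by (intro add_left_mono mult_mono) auto
    also have "\<dots> \<le> 300 * (?k + 1) * fact (?k + 1)"
      using \<open>(fact (?k + 1) :: nat) \<ge> 1\<close> by (cases "fact (?k + 1) :: nat") (auto simp: algebra_simps simp del: fact_Suc)
    finally show "cost_bound Skip + (?\<mu> (run Skip s) + 1) * (80 * (?k + 1) + 50 + 1 + acost (Reg rC) + acost (Reg rN))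
      \<le> 300 * (?k + 1) * fact (?k + 1)" using c N by (simp del: fact_Suc)
  qed simp
qed

section \<open>Filling the table row by row\<close>

definition table_body :: com where
  "table_body =
     SetReg rX (Arr aRank (Sub (Sub (Reg rLen) (Const 1)) (Reg rT))) ;;
     init_digits 0 (Const 0) ;; row ;; (incr rO (Reg rN) ;; incr rT (Const 1))"

definition table :: com where
  "table = (SetReg rO (Const 0) ;; SetReg rT (Const 0)) ;; WhileLess (Reg rT) (Reg rLen) table_body"

text \<open>As \<open>1 \<le> k + 1 \<le> P\<close>, the lower terms contribute at most
  \<open>67 * P\<close> per iteration, within the margin of \<open>100 * P\<close>.\<close>

lemma table_cost:
  fixes k n P :: nat
  assumes "k + 1 \<le> P"
  shows "4 + (n + 1) * (300 * P + 40 * (k + 1) + 23) \<le> 400 * (n + 1) * P"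
proof -
  have "300 * P + 40 * (k + 1) + 27 \<le> 400 * P" using assms by simp
  from mult_le_mono2[OF this, of "n + 1"] show ?thesis by (simp add: algebra_simps)
qed

lemma table_correct:
  assumes W: "\<forall>m \<le> fst s rK + 1. snd s aFact m = fact m" and N: "fst s rN = fact (fst s rK + 1)"
    and n: "fst s rLen = length xs" and R: "\<forall>i < length xs. snd s aRank i = xs ! i"
    and xs: "set xs \<subseteq> {1..fst s rK}" and V: "snd s aTab = (\<lambda>_. 0)"
  shows "terminates table (400 * (length xs + 1) * (fst s rK + 1) * fact (fst s rK + 1)) (\<lambda>s'.
    fst s' rO = length xs * fst s rN \<and> (\<forall>u \<le> length xs. \<forall>d. (\<forall>m \<in> {1..fst s rK}. d m \<le> m) \<longrightarrow>
      snd s' aTab (u * fst s rN + code (fst s rK) d) = best (drop (length xs - u) xs) d)) s"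
proof -
  let ?k = "fst s rK" and ?N = "fst s rN" and ?n = "length xs"
  let ?valid = "\<lambda>d. \<forall>m \<in> {1..?k}. d m \<le> m"
  let ?I = "\<lambda>s'. fst s' rT \<le> ?n \<and> fst s' rO = fst s' rT * ?N \<and> (\<forall>u \<le> fst s' rT. \<forall>d. ?valid d \<longrightarrow>
    snd s' aTab (u * ?N + code ?k d) = best (drop (?n - u) xs) d)"
  let ?\<mu> = "\<lambda>s'. ?n - fst s' rT"
  let ?B = "300 * (?k + 1) * fact (?k + 1)"
  show ?thesis
    unfolding table_def
  proof (rule terminates_loop[where I = ?I and \<mu> = ?\<mu> and b = "?B + 40 * (?k + 1) + 20"])
    show "?I (run (SetReg rO (Const 0) ;; SetReg rT (Const 0)) s)" using V by simp
    fix s' assume I: "?I s'" and fr: "frame table_body (run (SetReg rO (Const 0) ;; SetReg rT (Const 0)) s) s'"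
    have f: "fst s' rK = ?k" "fst s' rLen = ?n" "fst s' rN = ?N" "snd s' aFact = snd s aFact" "snd s' aRank = snd s aRank"
      using frame_reg[OF fr] frame_arr[OF fr] n
      by (auto simp: table_body_def row_def row_body_def new_code_def new_code_body_def odometer_def odometer_body_def
          init_digits_def init_digits_body_def)
    let ?t = "fst s' rT" and ?o = "fst s' rO"
    { assume "aval (Reg rT) s' < aval (Reg rLen) s'"
      then have t: "?t < ?n" using f by simp
      let ?s1 = "run (SetReg rX (Arr aRank (Sub (Sub (Reg rLen) (Const 1)) (Reg rT)))) s'"
      \<comment> \<open>After \<open>t\<close> iterations the last \<open>t\<close> elements are
        done, so the next one has index \<open>n - 1 - t\<close> and goes in front of them.\<close>
      let ?ys = "drop (?n - ?t) xs" and ?x = "xs ! (?n - 1 - ?t)"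
      have ys: "drop (?n - Suc ?t) xs = ?x # ?ys"
        using t Cons_nth_drop_Suc[of "?n - Suc ?t" xs] by (simp add: Suc_diff_Suc)
      have ysk: "set (?x # ?ys) \<subseteq> {1..?k}" unfolding ys[symmetric] using set_drop_subset xs by fastforce
      have s1: "fst ?s1 rX = ?x" "fst ?s1 rK = ?k" "snd ?s1 = snd s'" using f t R by auto
      show "terminates table_body (?B + 40 * (?k + 1) + 20) (\<lambda>s''. ?I s'' \<and> ?\<mu> s'' < ?\<mu> s') s'"
        unfolding table_body_def
      proof (rule terminates_Seq_loop_free[where b' = "?B + 40 * (?k + 1) + 12"])
        show "terminates (init_digits 0 (Const 0) ;; row ;; (incr rO (Reg rN) ;; incr rT (Const 1))) (?B + 40 * (?k + 1) + 12)
          (\<lambda>s''. ?I s'' \<and> ?\<mu> s'' < ?\<mu> s') ?s1"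
        proof (rule terminates_Seq[OF init_digits_correct])
          show "\<forall>m \<le> fst ?s1 rK + 1. snd ?s1 aFact m = fact m" using W f s1 by simp
          show "40 * (fst ?s1 rK + 1) + (?B + 12) \<le> ?B + 40 * (?k + 1) + 12" using s1(2) by (simp del: run.simps)
          fix s2 assume D: "(\<forall>m \<in> {1..fst ?s1 rK}. snd s2 aDig m = 0) \<and> snd s2 aDig (fst ?s1 rK + 1) = 0 \<and>
              fst s2 rC = code (fst ?s1 rK) (\<lambda>_. 0)"
            and fr: "frame (init_digits 0 (Const 0)) ?s1 s2"
          have s2: "fst s2 rK = ?k" "fst s2 rX = ?x" "fst s2 rN = ?N" "fst s2 rO = ?o" "fst s2 rT = ?t"
            "snd s2 aFact = snd s aFact" "snd s2 aTab = snd s' aTab" "fst s2 rC = 0"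
            "\<forall>m \<in> {1..?k + 1}. snd s2 aDig m = 0"
            using frame_reg[OF fr] frame_arr[OF fr] f s1 D
            by (auto simp: init_digits_def init_digits_body_def code_def atLeastAtMostSuc_conv)
          show "terminates (row ;; (incr rO (Reg rN) ;; incr rT (Const 1))) (?B + 12)
            (\<lambda>s''. ?I s'' \<and> ?\<mu> s'' < ?\<mu> s') s2"
          proof (rule terminates_Seq[OF row_correct[where xs = ?ys]])
            show "\<forall>m \<le> fst s2 rK + 1. snd s2 aFact m = fact m" using W s2 by simp
            show "fst s2 rN = fact (fst s2 rK + 1)" using N s2 by simp
            show "fst s2 rC = 0" using s2 by simp
            show "fst s2 rX \<in> {1..fst s2 rK}" "set ?ys \<subseteq> {1..fst s2 rK}" using s2 ysk by auto
            show "\<forall>m \<in> {1..fst s2 rK + 1}. snd s2 aDig m = 0" using s2 by simp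
            show "snd s2 aTab (fst s2 rO + code (fst s2 rK) d) = best ?ys d" if "\<forall>m \<in> {1..fst s2 rK}. d m \<le> m" for d
              using I s2 that by simp
            show "300 * (fst s2 rK + 1) * fact (fst s2 rK + 1) + 12 \<le> ?B + 12" using s2 by simp
            fix s3 assume T: "(\<forall>a < fst s2 rO + fst s2 rN. snd s3 aTab a = snd s2 aTab a) \<and>
                (\<forall>d. (\<forall>m \<in> {1..fst s2 rK}. d m \<le> m) \<longrightarrow>
                  snd s3 aTab (fst s2 rO + fst s2 rN + code (fst s2 rK) d) = best (fst s2 rX # ?ys) d)"
              and fr: "frame row s2 s3"
            have s3: "fst s3 rO = ?o" "fst s3 rT = ?t" "fst s3 rN = ?N"
              using frame_reg[OF fr] s2
              by (auto simp: row_def row_body_def new_code_def new_code_body_def odometer_def odometer_body_def)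
            have "snd s3 aTab (u * ?N + code ?k d) = best (drop (?n - u) xs) d" if u: "u \<le> Suc ?t" "?valid d" for u d
            proof (cases "u = Suc ?t")
              case True
              have eq: "fst s2 rO + fst s2 rN = u * ?N" using True s2 I by simp
              have "snd s3 aTab (fst s2 rO + fst s2 rN + code ?k d) = best (?x # ?ys) d"
                using T u s2 by (simp del: best.simps)
              then show ?thesis unfolding eq ys[symmetric] using True by simp
            next
              case False
              then have ut: "u \<le> ?t" using u by simp
              \<comment> \<open>An earlier row \<open>u \<le> t\<close> ends before address
                \<open>(t + 1) * N\<close>, where the new row begins.\<close>
              have "u * ?N + code ?k d < u * ?N + ?N" using code_less[OF u(2)] N by simp
              also have "\<dots> \<le> ?o + ?N" using ut I by simp
              finally show ?thesis using T s2 ut I u by simp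
            qed
            then show "terminates (incr rO (Reg rN) ;; incr rT (Const 1)) 12 (\<lambda>s''. ?I s'' \<and> ?\<mu> s'' < ?\<mu> s') s3"
              by (intro terminates_loop_free) (use s3 t I in auto)
          qed
        qed simp_all
      qed auto }
    { assume "\<not> aval (Reg rT) s' < aval (Reg rLen) s'"
      then have "?t = ?n" using I f by simp
      then show "?o = ?n * ?N \<and> (\<forall>u \<le> ?n. \<forall>d. ?valid d \<longrightarrow>
        snd s' aTab (u * ?N + code ?k d) = best (drop (?n - u) xs) d)" using I by simp }
  next
    define P :: nat where "P = (?k + 1) * fact (?k + 1)"
    have "?k + 1 \<le> P" unfolding P_def using mult_left_mono[OF fact_ge_1, of "?k + 1" "?k + 1"] by simp
    then have "4 + (?n + 1) * (300 * P + 40 * (?k + 1) + 23) \<le> 400 * (?n + 1) * P" by (rule table_cost)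
    then show "cost_bound (SetReg rO (Const 0) ;; SetReg rT (Const 0)) +
      (?\<mu> (run (SetReg rO (Const 0) ;; SetReg rT (Const 0)) s) + 1) *
        (?B + 40 * (?k + 1) + 20 + 1 + acost (Reg rT) + acost (Reg rLen))
      \<le> 400 * (length xs + 1) * (?k + 1) * fact (?k + 1)"
      by (simp only: P_def cost_bound.simps run.simps acost.simps aval.simps fst_conv fun_upd_same mult.assoc) simp
  qed simp
qed

section \<open>The forward pass\<close>

text \<open>A null-terminated linked list; the null pointer 0 is also the default content of an
  array.\<close>

primrec chain :: "(nat \<Rightarrow> nat) \<Rightarrow> nat \<Rightarrow> nat list \<Rightarrow> bool" where
  "chain f h [] \<longleftrightarrow> h = 0"
| "chain f h (y # ys) \<longleftrightarrow> h = y \<and> 0 < y \<and> chain f (f y) ys"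

lemma chain_cong: "\<forall>y \<in> set ys. f y = g y \<Longrightarrow> chain f h ys \<longleftrightarrow> chain g h ys"
  by (induction ys arbitrary: h) auto

text \<open>
  A free position is a number \<open>y > 0\<close> belonging to the vertex \<open>y div 2\<close>; the positions of rank \<open>m\<close>
  form a linked list starting at \<open>hp m\<close>. Position \<open>1\<close>, of the fictitious vertex \<open>0\<close>, is the one
  for the root.
\<close>

definition represents ::
  "(nat \<Rightarrow> nat) \<Rightarrow> nat \<Rightarrow> nat \<Rightarrow> (nat \<Rightarrow> nat) \<Rightarrow> (nat \<Rightarrow> nat) \<Rightarrow> (nat \<Rightarrow> nat) \<Rightarrow> nat multiset \<Rightarrow> bool" where
  "represents rk k t hp nx pr N \<longleftrightarrow> (\<exists>L. \<forall>m \<le> k. chain nx (hp m) (L m) \<and>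
     (\<forall>y \<in> set (L m). y < 2 * t + 2 \<and> pr y = y div 2) \<and>
     mset (map (\<lambda>y. y div 2) (L m)) = filter_mset (\<lambda>v. rk v = m) N)"

lemma represents_empty_iff:
  assumes "represents rk k t hp nx pr N" "m \<le> k"
  shows "hp m = 0 \<longleftrightarrow> (\<forall>v \<in># N. rk v \<noteq> m)"
proof -
  from assms obtain L where L: "chain nx (hp m) L" "mset (map (\<lambda>y. y div 2) L) = filter_mset (\<lambda>v. rk v = m) N"
    unfolding represents_def by blast
  have "hp m = 0 \<longleftrightarrow> L = []" using L(1) by (cases L) auto
  also have "\<dots> \<longleftrightarrow> filter_mset (\<lambda>v. rk v = m) N = {#}" using L(2) by (metis map_is_Nil_conv mset_zero_iff)
  also have "\<dots> \<longleftrightarrow> set_mset (filter_mset (\<lambda>v. rk v = m) N) = {}" by (simp only: set_mset_eq_empty_iff)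
  finally show ?thesis by auto
qed

text \<open>The owner \<open>y div 2\<close> of a position is read from \<open>pr\<close> because
  the machine has no division.\<close>

lemma represents_pop:
  assumes R: "represents rk k t hp nx pr N" and m: "m \<le> k" "hp m \<noteq> 0"
  shows "pr (hp m) \<in># N" "rk (pr (hp m)) = m"
    "represents rk k t (hp(m := nx (hp m))) nx pr (N - {#pr (hp m)#})"
proof -
  from R obtain L where L: "\<forall>m \<le> k. chain nx (hp m) (L m) \<and>
     (\<forall>y \<in> set (L m). y < 2 * t + 2 \<and> pr y = y div 2) \<and>
     mset (map (\<lambda>y. y div 2) (L m)) = filter_mset (\<lambda>v. rk v = m) N"
    unfolding represents_def by blast
  then have Lm: "chain nx (hp m) (L m)" "\<forall>y \<in> set (L m). y < 2 * t + 2 \<and> pr y = y div 2"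
    "mset (map (\<lambda>y. y div 2) (L m)) = filter_mset (\<lambda>v. rk v = m) N" using m by auto
  with m obtain ys where ys: "L m = hp m # ys" by (cases "L m") auto
  have p: "pr (hp m) = hp m div 2" using Lm ys by simp
  have eq: "add_mset (pr (hp m)) (mset (map (\<lambda>y. y div 2) ys)) = filter_mset (\<lambda>v. rk v = m) N"
    using Lm(3) ys p by simp
  then have "pr (hp m) \<in># filter_mset (\<lambda>v. rk v = m) N" by (metis union_single_eq_member)
  then show pN: "pr (hp m) \<in># N" and rk: "rk (pr (hp m)) = m" by auto
  have "\<forall>m' \<le> k. chain nx ((hp(m := nx (hp m))) m') ((L(m := ys)) m') \<and>
     (\<forall>y \<in> set ((L(m := ys)) m'). y < 2 * t + 2 \<and> pr y = y div 2) \<and>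
     mset (map (\<lambda>y. y div 2) ((L(m := ys)) m')) = filter_mset (\<lambda>v. rk v = m') (N - {#pr (hp m)#})"
  proof (intro allI impI)
    fix m' assume "m' \<le> k"
    show "chain nx ((hp(m := nx (hp m))) m') ((L(m := ys)) m') \<and>
     (\<forall>y \<in> set ((L(m := ys)) m'). y < 2 * t + 2 \<and> pr y = y div 2) \<and>
     mset (map (\<lambda>y. y div 2) ((L(m := ys)) m')) = filter_mset (\<lambda>v. rk v = m') (N - {#pr (hp m)#})"
    proof (cases "m' = m")
      case True
      have "mset (map (\<lambda>y. y div 2) ys) = filter_mset (\<lambda>v. rk v = m) N - {#pr (hp m)#}"
        using eq by (metis add_mset_remove_trivial)
      then show ?thesis using True Lm ys rk by simp
    next
      case False
      then show ?thesis using L \<open>m' \<le> k\<close> rk by simp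
    qed
  qed
  then show "represents rk k t (hp(m := nx (hp m))) nx pr (N - {#pr (hp m)#})"
    unfolding represents_def by blast
qed

text \<open>All linked positions lie below \<open>2 * t + 2\<close>, so the two positions
  \<open>2 * t + 2\<close> and \<open>2 * t + 3\<close> of vertex \<open>t + 1\<close> are fresh,
  and writing their entries disturbs no list.\<close>

lemma represents_push:
  assumes R: "represents rk k t hp nx pr N" and x: "rk (Suc t) = x" "x \<le> k" and q: "q = 2 * t + 2"
  shows "represents rk k (Suc t) (hp(x := Suc q)) (nx(q := hp x, Suc q := q)) (pr(q := Suc t, Suc q := Suc t))
    (N + {#Suc t, Suc t#})"
proof -
  from R obtain L where L: "\<forall>m \<le> k. chain nx (hp m) (L m) \<and>
     (\<forall>y \<in> set (L m). y < 2 * t + 2 \<and> pr y = y div 2) \<and>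
     mset (map (\<lambda>y. y div 2) (L m)) = filter_mset (\<lambda>v. rk v = m) N"
    unfolding represents_def by blast
  let ?nx = "nx(q := hp x, Suc q := q)" and ?pr = "pr(q := Suc t, Suc q := Suc t)"
  let ?L = "L(x := Suc q # q # L x)"
  have "chain ?nx ((hp(x := Suc q)) m) (?L m) \<and>
     (\<forall>y \<in> set (?L m). y < 2 * Suc t + 2 \<and> ?pr y = y div 2) \<and>
     mset (map (\<lambda>y. y div 2) (?L m)) = filter_mset (\<lambda>v. rk v = m) (N + {#Suc t, Suc t#})" if m: "m \<le> k" for m
  proof -
    have Lm: "chain nx (hp m) (L m)" "\<forall>y \<in> set (L m). y < 2 * t + 2 \<and> pr y = y div 2"
      "mset (map (\<lambda>y. y div 2) (L m)) = filter_mset (\<lambda>v. rk v = m) N" using L m by auto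
    have ch: "chain ?nx h (L m) \<longleftrightarrow> chain nx h (L m)" for h
      using Lm(2) q by (intro chain_cong) auto
    have pr: "\<forall>y \<in> set (L m). y < 2 * Suc t + 2 \<and> ?pr y = y div 2"
      using Lm(2) q by auto
    show ?thesis
    proof (cases "m = x")
      case True
      have "Suc q div 2 = Suc t" "q div 2 = Suc t" using q by auto
      then show ?thesis using True Lm ch pr x q by auto
    next
      case False
      then show ?thesis using Lm ch pr x by auto
    qed
  qed
  then show ?thesis unfolding represents_def by blast
qed

lemma represents_Suc: "represents rk k t hp nx pr N \<Longrightarrow> represents rk k (Suc t) hp nx pr N"
  unfolding represents_def by fastforce

text \<open>Elements have rank at least 1, so the list of rank 0 is reserved for the root
  position.\<close>

definition vrank :: "nat list \<Rightarrow> nat \<Rightarrow> nat" where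
  "vrank \<tau> v = (if v = 0 then 0 else rank \<tau> (\<tau> ! (v - 1)))"

lemma assigns_attach_next:
  assumes "assigns \<tau> vs ps N" "\<forall>v \<in> set vs. v \<le> t" "t < length \<tau>" "p \<in># N" "vrank \<tau> p \<le> rank \<tau> (\<tau> ! t)"
  shows "assigns \<tau> (vs @ [Suc t]) (ps @ [p]) (N - {#p#} + {#Suc t, Suc t#})"
proof (rule assigns.attach[OF assms(1,4)])
  have "\<tau> ! (p - 1) \<in> set \<tau>" if "p \<noteq> 0"
    using assigns_basic(3,4)[OF assms(1)] assms(4) that by fastforce
  then show "vval \<tau> p \<le> vval \<tau> (Suc t)"
    using assms(5) rank_le_iff[of "\<tau> ! (p - 1)" \<tau> "\<tau> ! t"] by (auto simp: vval_def vrank_def split: if_splits)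
qed (use assms in auto)

section \<open>Programs of the forward pass\<close>

definition find_slot :: com where
  "find_slot = SetReg rI (Reg rX) ;; WhileLess (Arr aHead (Reg rI)) (Const 1) (SetReg rI (Sub (Reg rI) (Const 1)))"

text \<open>The nonempty list at some \<open>m\<close> up to the current rank stops the descent
  before truncated subtraction could leave the index stuck at an empty list 0.\<close>

lemma find_slot_correct:
  assumes "m \<le> fst s rX" "snd s aHead m \<noteq> 0"
  shows "terminates find_slot (20 * (fst s rX + 1)) (\<lambda>s'. fst s' rI \<le> fst s rX \<and> snd s aHead (fst s' rI) \<noteq> 0 \<and>
    (\<forall>m. fst s' rI < m \<longrightarrow> m \<le> fst s rX \<longrightarrow> snd s aHead m = 0)) s"
proof -
  let ?I = "\<lambda>s'. fst s' rI \<le> fst s rX \<and> (\<forall>m. fst s' rI < m \<longrightarrow> m \<le> fst s rX \<longrightarrow> snd s aHead m = 0)"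
  show ?thesis
    unfolding find_slot_def
  proof (rule terminates_loop[where I = ?I and \<mu> = "\<lambda>s'. fst s' rI" and b = 4])
    fix s' assume I: "?I s'" and fr: "frame (SetReg rI (Sub (Reg rI) (Const 1))) (run (SetReg rI (Reg rX)) s) s'"
    have f: "snd s' = snd s" using frame_arr[OF fr] by auto
    { assume "aval (Arr aHead (Reg rI)) s' < aval (Const 1) s'"
      then have z: "snd s aHead (fst s' rI) = 0" using f by simp
      then have "fst s' rI \<noteq> 0" using assms I by (metis not_gr_zero)
      moreover have "snd s aHead m = 0" if "fst s' rI - 1 < m" "m \<le> fst s rX" for m
        using I z that by (cases "m = fst s' rI") auto
      ultimately show "terminates (SetReg rI (Sub (Reg rI) (Const 1))) 4 (\<lambda>s''. ?I s'' \<and> fst s'' rI < fst s' rI) s'"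
        by (intro terminates_loop_free) (use I in auto) }
    { assume "\<not> aval (Arr aHead (Reg rI)) s' < aval (Const 1) s'"
      then show "fst s' rI \<le> fst s rX \<and> snd s aHead (fst s' rI) \<noteq> 0 \<and>
        (\<forall>m. fst s' rI < m \<longrightarrow> m \<le> fst s rX \<longrightarrow> snd s aHead m = 0)" using I f by simp }
  qed auto
qed

definition update_digits_body :: com where
  "update_digits_body =
     IfLess (Reg rI) (Reg rX)
       (IfLess (Arr aDig (Reg rI)) (Arr aDig (Reg rX)) Skip (SetArr aDig (Reg rI) (Sub (Arr aDig (Reg rI)) (Const 1))))
       (IfLess (Arr aDig (Reg rI)) (Reg rI) (SetArr aDig (Reg rI) (Add (Arr aDig (Reg rI)) (Const 1))) Skip) ;;
     incr rI (Const 1)"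

definition update_digits :: com where
  "update_digits = SetReg rI (Const 1) ;; WhileLess (Reg rI) (Add (Reg rK) (Const 1)) update_digits_body"

text \<open>Updating in place is safe: other digits consult the one at \<open>x\<close> only for
  indices below \<open>x\<close>, before it can change itself.\<close>

lemma update_digits_correct:
  "terminates update_digits (40 * (fst s rK + 1))
    (\<lambda>s'. \<forall>m \<in> {1..fst s rK}. snd s' aDig m = upd (fst s rX) (snd s aDig) m) s"
proof -
  let ?k = "fst s rK" and ?x = "fst s rX" and ?d = "snd s aDig"
  let ?I = "\<lambda>s'. 1 \<le> fst s' rI \<and> fst s' rI \<le> ?k + 1 \<and>
    (\<forall>m. snd s' aDig m = (if m \<in> {1..<fst s' rI} then upd ?x ?d m else ?d m))"
  let ?\<mu> = "\<lambda>s'. ?k + 1 - fst s' rI"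
  show ?thesis
    unfolding update_digits_def
  proof (rule terminates_loop[where I = ?I and \<mu> = ?\<mu> and b = 24])
    fix s' assume I: "?I s'" and fr: "frame update_digits_body (run (SetReg rI (Const 1)) s) s'"
    have f: "fst s' rK = ?k" "fst s' rX = ?x"
      using frame_reg[OF fr] by (auto simp: update_digits_body_def)
    { assume "aval (Reg rI) s' < aval (Add (Reg rK) (Const 1)) s'"
      then have i: "fst s' rI < ?k + 1" using f by simp
      let ?i = "fst s' rI"
      have di: "snd s' aDig ?i = ?d ?i" "?i < ?x \<Longrightarrow> snd s' aDig ?x = ?d ?x" using I by auto
      let ?r = "run update_digits_body s'"
      have "snd ?r aDig = (snd s' aDig)(?i := upd ?x ?d ?i)" "fst ?r rI = Suc ?i"
        using di f by (auto simp: update_digits_body_def upd_def)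
      then have "?I ?r \<and> ?\<mu> ?r < ?\<mu> s'" using I i by (auto simp: less_Suc_eq)
      then show "terminates update_digits_body 24 (\<lambda>s''. ?I s'' \<and> ?\<mu> s'' < ?\<mu> s') s'"
        by (intro terminates_loop_free) (auto simp: update_digits_body_def) }
    { assume "\<not> aval (Reg rI) s' < aval (Add (Reg rK) (Const 1)) s'"
      then have "fst s' rI = ?k + 1" using I f by simp
      then show "\<forall>m \<in> {1..?k}. snd s' aDig m = upd ?x ?d m" using I by auto }
  qed auto
qed

text \<open>The chosen position is unlinked before the two new ones are linked in, so the case of
  both lists being the same is covered.\<close>

definition place :: com where
  "place =
     SetReg rP (Arr aHead (Reg rI)) ;; SetArr aHead (Reg rI) (Arr aNext (Reg rP)) ;;
     SetArr aXs (Reg rM) (Arr aIn (Reg rT)) ;; SetArr aVs (Reg rM) (Add (Reg rT) (Const 1)) ;;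
     SetArr aPs (Reg rM) (Arr aPar (Reg rP)) ;; incr rM (Const 1) ;;
     SetReg rP (Add (Add (Reg rT) (Reg rT)) (Const 2)) ;;
     SetArr aNext (Reg rP) (Arr aHead (Reg rX)) ;; SetArr aNext (Add (Reg rP) (Const 1)) (Reg rP) ;;
     SetArr aHead (Reg rX) (Add (Reg rP) (Const 1)) ;;
     SetArr aPar (Reg rP) (Add (Reg rT) (Const 1)) ;;
     SetArr aPar (Add (Reg rP) (Const 1)) (Add (Reg rT) (Const 1))"

lemma run_place:
  fixes s :: state
  defines "i \<equiv> fst s rI" and "t \<equiv> fst s rT" and "y \<equiv> snd s aHead (fst s rI)"
    and "q \<equiv> 2 * fst s rT + 2" and "x \<equiv> fst s rX" and "c \<equiv> fst s rM"
  defines "hp \<equiv> (snd s aHead)(i := snd s aNext y)"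
  shows "fst (run place s) rM = Suc c" "fst (run place s) rC = fst s rC" "snd (run place s) aDig = snd s aDig"
    "snd (run place s) aHead = hp(x := Suc q)"
    "snd (run place s) aNext = (snd s aNext)(q := hp x, Suc q := q)"
    "snd (run place s) aPar = (snd s aPar)(q := Suc t, Suc q := Suc t)"
    "snd (run place s) aXs = (snd s aXs)(c := snd s aIn t)"
    "snd (run place s) aVs = (snd s aVs)(c := Suc t)"
    "snd (run place s) aPs = (snd s aPs)(c := snd s aPar y)"
  unfolding place_def assms by (simp_all add: mult_2)

definition take_element :: com where
  "take_element = SetReg rC (Reg rC') ;; update_digits ;; find_slot ;; place"

text \<open>The last conjunct says that the choices made so far still extend to an optimum. The
  digits equal the truncated counts instead of merely bounding them, so that a positive digit
  guarantees an actual free position.\<close>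

definition forward_inv :: "nat list \<Rightarrow> nat \<Rightarrow> state \<Rightarrow> bool" where
  "forward_inv \<tau> t s \<longleftrightarrow> fst s rC = code (card (set \<tau>)) (snd s aDig) \<and>
     (\<exists>vs ps N. assigns \<tau> vs ps N \<and> (\<forall>v \<in> set vs. v \<le> t) \<and> fst s rM = length vs \<and>
       (\<forall>i < length vs. snd s aXs i = vval \<tau> (vs ! i) \<and> snd s aVs i = vs ! i \<and> snd s aPs i = ps ! i) \<and>
       represents (vrank \<tau>) (card (set \<tau>)) t (snd s aHead) (snd s aNext) (snd s aPar) N \<and>
       (\<forall>m \<in> {1..card (set \<tau>)}. snd s aDig m = min m (slot_count (image_mset (vrank \<tau>) N) m)) \<and>
       length vs + best (drop t (map (rank \<tau>) \<tau>)) (snd s aDig) = best (map (rank \<tau>) \<tau>) (\<lambda>_. 1))"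

lemma forward_inv_skip:
  assumes "forward_inv \<tau> t s"
    "best (drop (Suc t) (map (rank \<tau>) \<tau>)) (snd s aDig) = best (drop t (map (rank \<tau>) \<tau>)) (snd s aDig)"
  shows "forward_inv \<tau> (Suc t) s"
  using assms unfolding forward_inv_def by (metis represents_Suc le_SucI)

lemma take_element_correct:
  assumes inv: "forward_inv \<tau> t s" and t: "t < length \<tau>" "fst s rT = t" and x: "fst s rX = rank \<tau> (\<tau> ! t)"
    and k: "fst s rK = card (set \<tau>)" and d: "0 < snd s aDig (fst s rX)" and inp: "snd s aIn t = \<tau> ! t"
    and c: "fst s rC' = code (card (set \<tau>)) (upd (fst s rX) (snd s aDig))"
    and best: "best (drop t (map (rank \<tau>) \<tau>)) (snd s aDig) =
      Suc (best (drop (Suc t) (map (rank \<tau>) \<tau>)) (upd (fst s rX) (snd s aDig)))"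
  shows "terminates take_element (110 * (card (set \<tau>) + 1)) (forward_inv \<tau> (Suc t)) s"
proof -
  let ?k = "card (set \<tau>)" and ?x = "fst s rX" and ?d = "snd s aDig"
  from inv obtain vs ps N where asg: "assigns \<tau> vs ps N" "\<forall>v \<in> set vs. v \<le> t" and cnt: "fst s rM = length vs"
    and out: "\<forall>i < length vs. snd s aXs i = vval \<tau> (vs ! i) \<and> snd s aVs i = vs ! i \<and> snd s aPs i = ps ! i"
    and rep: "represents (vrank \<tau>) ?k t (snd s aHead) (snd s aNext) (snd s aPar) N"
    and dig: "\<forall>m \<in> {1..?k}. ?d m = min m (slot_count (image_mset (vrank \<tau>) N) m)"
    and opt: "length vs + best (drop t (map (rank \<tau>) \<tau>)) ?d = best (map (rank \<tau>) \<tau>) (\<lambda>_. 1)"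
    unfolding forward_inv_def by blast
  have xk: "?x \<in> {1..?k}" using rank_range[of "\<tau> ! t" \<tau>] t x by auto
  let ?R = "image_mset (vrank \<tau>) N"
  have "slot_count ?R ?x > 0" using d dig xk by auto
  then have "filter_mset (\<lambda>v. v \<le> ?x) ?R \<noteq> {#}"
    unfolding slot_count_def by (metis size_empty less_irrefl)
  then obtain w where "w \<in># filter_mset (\<lambda>v. v \<le> ?x) ?R" by (meson multiset_nonemptyE)
  then obtain v where v: "v \<in># N" "vrank \<tau> v \<le> ?x" by auto
  have slot: "snd s aHead (vrank \<tau> v) \<noteq> 0"
    using represents_empty_iff[OF rep, of "vrank \<tau> v"] v xk by auto
  show ?thesis
    unfolding take_element_def
  proof (rule terminates_Seq_loop_free[where b' = "110 * (?k + 1) - 2"])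
    let ?s1 = "run (SetReg rC (Reg rC')) s"
    show "terminates (update_digits ;; find_slot ;; place) (110 * (?k + 1) - 2) (forward_inv \<tau> (Suc t)) ?s1"
    proof (rule terminates_Seq[OF update_digits_correct, where b\<^sub>2 = "20 * (?k + 1) + 70"])
      show "40 * (fst ?s1 rK + 1) + (20 * (?k + 1) + 70) \<le> 110 * (?k + 1) - 2" using k xk by simp
      fix s2 assume D: "\<forall>m \<in> {1..fst ?s1 rK}. snd s2 aDig m = upd (fst ?s1 rX) (snd ?s1 aDig) m"
        and fr: "frame update_digits ?s1 s2"
      have s2: "fst s2 rX = ?x" "fst s2 rT = t" "fst s2 rM = length vs" "fst s2 rC = fst s rC'"
        "\<forall>m \<in> {1..?k}. snd s2 aDig m = upd ?x ?d m" "\<And>a. a \<noteq> aDig \<Longrightarrow> snd s2 a = snd s a"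
        using frame_reg[OF fr] frame_arr[OF fr] D k t cnt by (auto simp: update_digits_def update_digits_body_def)
      show "terminates (find_slot ;; place) (20 * (?k + 1) + 70) (forward_inv \<tau> (Suc t)) s2"
      proof (rule terminates_Seq[OF find_slot_correct[of "vrank \<tau> v"], where b\<^sub>2 = 70])
        show "vrank \<tau> v \<le> fst s2 rX" "snd s2 aHead (vrank \<tau> v) \<noteq> 0" using v slot s2 by auto
        show "20 * (fst s2 rX + 1) + 70 \<le> 20 * (?k + 1) + 70" using s2 xk by auto
        fix s3 assume F: "fst s3 rI \<le> fst s2 rX \<and> snd s2 aHead (fst s3 rI) \<noteq> 0 \<and>
            (\<forall>m. fst s3 rI < m \<longrightarrow> m \<le> fst s2 rX \<longrightarrow> snd s2 aHead m = 0)"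
          and fr: "frame find_slot s2 s3"
        have s3: "fst s3 rX = ?x" "fst s3 rT = t" "fst s3 rM = length vs" "fst s3 rC = fst s rC'"
          "snd s3 = snd s2"
          using frame_reg[OF fr] frame_arr[OF fr] s2 by (auto simp: find_slot_def)
        let ?i = "fst s3 rI"
        define p where "p = snd s aPar (snd s aHead ?i)"
        have i: "?i \<le> ?x" "?i \<le> ?k" "snd s aHead ?i \<noteq> 0" "\<And>m. ?i < m \<Longrightarrow> m \<le> ?x \<Longrightarrow> snd s aHead m = 0"
          using F s2 xk by auto
        note pop = represents_pop[OF rep i(2,3), folded p_def]
        let ?N = "N - {#p#} + {#Suc t, Suc t#}"
        have rt: "vrank \<tau> (Suc t) = ?x" using x by (simp add: vrank_def)
        have asg': "assigns \<tau> (vs @ [Suc t]) (ps @ [p]) ?N"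
          using asg t pop i x by (intro assigns_attach_next) auto
        \<comment> \<open>A usable label above that of \<open>p\<close> would make one of the lists
          skipped by the search nonempty.\<close>
        have greatest: "w \<le> vrank \<tau> p" if "w \<in># ?R" "w \<le> ?x" for w
        proof (rule ccontr)
          assume "\<not> w \<le> vrank \<tau> p"
          then have "snd s aHead w = 0" using i(4)[of w] that pop(2) by simp
          then show False using represents_empty_iff[OF rep, of w] that xk by auto
        qed
        have R': "image_mset (vrank \<tau>) ?N = ?R - {#vrank \<tau> p#} + {#?x, ?x#}"
          using image_mset_replace[OF pop(1), of "vrank \<tau>" "Suc t"] rt by simp
        have dig': "\<forall>m \<in> {1..?k}. snd s2 aDig m = min m (slot_count (image_mset (vrank \<tau>) ?N) m)"
        proof
          fix m assume m: "m \<in> {1..?k}"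
          have "upd ?x ?d m = min m (slot_count (?R - {#vrank \<tau> p#} + {#?x, ?x#}) m)"
          proof (rule upd_exact)
            show "vrank \<tau> p \<in># ?R" using pop(1) by simp
            show "vrank \<tau> p \<le> ?x" using pop(2) i(1) by simp
          qed (use greatest dig m xk in \<open>simp_all del: set_image_mset\<close>)
          then show "snd s2 aDig m = min m (slot_count (image_mset (vrank \<tau>) ?N) m)"
            using s2(5) m R' by simp
        qed
        note rp = run_place[of s3, unfolded s3]
        have rep': "represents (vrank \<tau>) ?k (Suc t) (snd (run place s3) aHead) (snd (run place s3) aNext)
          (snd (run place s3) aPar) ?N"
          unfolding rp using represents_push[OF pop(3) rt _ refl] xk s2(6) by simp
        have "snd (run place s3) aDig = snd s2 aDig" using rp by simp
        moreover have "fst (run place s3) rC = code ?k (snd s2 aDig)"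
          using rp(2) c code_cong[OF s2(5)] by simp
        moreover have "length (vs @ [Suc t]) + best (drop (Suc t) (map (rank \<tau>) \<tau>)) (snd s2 aDig) =
          best (map (rank \<tau>) \<tau>) (\<lambda>_. 1)"
        proof -
          have "set (drop (Suc t) (map (rank \<tau>) \<tau>)) \<subseteq> {1..?k}"
            using set_drop_subset[of "Suc t" "map (rank \<tau>) \<tau>"] rank_range by fastforce
          then have "best (drop (Suc t) (map (rank \<tau>) \<tau>)) (snd s2 aDig) =
            best (drop (Suc t) (map (rank \<tau>) \<tau>)) (upd ?x ?d)"
            using s2(5) by (intro best_cong)
          then show ?thesis using opt best by simp
        qed
        moreover have "\<forall>i < length (vs @ [Suc t]). snd (run place s3) aXs i = vval \<tau> ((vs @ [Suc t]) ! i) \<and>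
          snd (run place s3) aVs i = (vs @ [Suc t]) ! i \<and> snd (run place s3) aPs i = (ps @ [p]) ! i"
          using out rp s2(6) inp assigns_basic(1)[OF asg(1)]
          by (auto simp: nth_append less_Suc_eq vval_def p_def)
        moreover have "\<forall>v \<in> set (vs @ [Suc t]). v \<le> Suc t" using asg(2) by auto
        moreover have "fst (run place s3) rM = length (vs @ [Suc t])" using rp by simp
        ultimately have "forward_inv \<tau> (Suc t) (run place s3)"
          unfolding forward_inv_def using asg' rep' dig' by (simp only:) blast
        then show "terminates place 70 (forward_inv \<tau> (Suc t)) s3"
          by (intro terminates_loop_free) (auto simp: place_def)
      qed
    qed
  qed auto
qed

text \<open>Subtracting \<open>N\<close> from the offset moves to the row of the next shorter
  suffix. An element is taken only if that is strictly better than passing it over.\<close>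

definition forward_body :: com where
  "forward_body =
     (SetReg rX (Arr aRank (Reg rT)) ;; SetReg rO (Sub (Reg rO) (Reg rN))) ;;
     new_code ;;
     IfLess (Const 0) (Arr aDig (Reg rX))
       (IfLess (Arr aTab (Add (Reg rO) (Reg rC))) (Add (Arr aTab (Add (Reg rO) (Reg rC'))) (Const 1))
         take_element Skip)
       Skip ;;
     incr rT (Const 1)"

definition forward :: com where
  "forward = (SetArr aHead (Const 0) (Const 1) ;; SetReg rT (Const 0) ;; SetReg rM (Const 0)) ;;
     WhileLess (Reg rT) (Reg rLen) forward_body"

lemma written_forward_body:
  "written_regs forward_body = {rX, rO, rC', rI, rC, rP, rM, rT}"
  "written_arrs forward_body = {aDig, aHead, aNext, aPar, aXs, aVs, aPs}"
  by (auto simp: forward_body_def new_code_def new_code_body_def take_element_def update_digits_def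
      update_digits_body_def find_slot_def place_def)

lemma forward_correct:
  assumes W: "\<forall>m \<le> fst s rK + 1. snd s aFact m = fact m" and N: "fst s rN = fact (fst s rK + 1)"
    and k: "fst s rK = card (set \<tau>)" and n: "fst s rLen = length \<tau>"
    and inp: "\<forall>i < length \<tau>. snd s aIn i = \<tau> ! i"
    and R: "\<forall>i < length \<tau>. snd s aRank i = rank \<tau> (\<tau> ! i)"
    and T: "\<forall>u \<le> length \<tau>. \<forall>d. (\<forall>m \<in> {1..fst s rK}. d m \<le> m) \<longrightarrow>
      snd s aTab (u * fst s rN + code (fst s rK) d) = best (drop (length \<tau> - u) (map (rank \<tau>) \<tau>)) d"
    and O: "fst s rO = length \<tau> * fst s rN"
    and c: "fst s rC = code (fst s rK) (snd s aDig)" and d: "\<forall>m \<in> {1..fst s rK}. snd s aDig m = 1"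
    and z: "snd s aHead = (\<lambda>_. 0)" "snd s aNext = (\<lambda>_. 0)" "snd s aPar = (\<lambda>_. 0)"
  shows "terminates forward (300 * (length \<tau> + 1) * (card (set \<tau>) + 1)) (forward_inv \<tau> (length \<tau>)) s"
proof -
  let ?k = "card (set \<tau>)" and ?n = "length \<tau>" and ?N = "fst s rN" and ?rs = "map (rank \<tau>) \<tau>"
  let ?c0 = "SetArr aHead (Const 0) (Const 1) ;; SetReg rT (Const 0) ;; SetReg rM (Const 0)"
  let ?I = "\<lambda>s'. fst s' rT \<le> ?n \<and> fst s' rO = (?n - fst s' rT) * ?N \<and> forward_inv \<tau> (fst s' rT) s'"
  let ?\<mu> = "\<lambda>s'. ?n - fst s' rT"
  have rs: "set ?rs \<subseteq> {1..?k}" using rank_range by fastforce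
  show ?thesis
    unfolding forward_def
  proof (rule terminates_loop[where I = ?I and \<mu> = ?\<mu> and b = "150 * (?k + 1) + 40"])
    \<comment> \<open>One array entry suffices to set up the root position 1: it heads list 0, its
      successor entry 0 ends the list, and its owner entry 0 equals \<open>1 div 2\<close>.\<close>
    have "represents (vrank \<tau>) ?k 0 ((snd s aHead)(0 := 1)) (snd s aNext) (snd s aPar) {#0#}"
      unfolding represents_def z
      by (rule exI[of _ "\<lambda>m. if m = 0 then [1] else []"]) (auto simp: vrank_def)
    moreover have "best ?rs (snd s aDig) = best ?rs (\<lambda>_. 1)"
      using d k rs by (intro best_cong[of ?k]) auto
    moreover have "\<forall>m \<in> {1..?k}. snd s aDig m = min m (slot_count (image_mset (vrank \<tau>) {#0#}) m)"
      using d k by (auto simp: slot_count_def vrank_def)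
    ultimately have "forward_inv \<tau> 0 (run ?c0 s)"
      unfolding forward_inv_def using c k assigns.init[of \<tau>]
      by (intro conjI exI[of _ "[]"] exI[of _ "{#0#}"]) auto
    then show "?I (run ?c0 s)" using O by simp
  next
    fix s' assume I: "?I s'" and fr: "frame forward_body (run ?c0 s) s'"
    have f: "fst s' rK = ?k" "fst s' rLen = ?n" "fst s' rN = ?N" "snd s' aFact = snd s aFact"
      "snd s' aRank = snd s aRank" "snd s' aTab = snd s aTab" "snd s' aIn = snd s aIn"
      using frame_reg[OF fr] frame_arr[OF fr] n k by (auto simp: written_forward_body)
    let ?t = "fst s' rT" and ?d = "snd s' aDig"
    assume "aval (Reg rT) s' < aval (Reg rLen) s'"
    then have t: "?t < ?n" using f by simp
    let ?x = "rank \<tau> (\<tau> ! ?t)" and ?o = "(?n - Suc ?t) * ?N"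
    let ?ys = "drop (Suc ?t) ?rs"
    have xk: "?x \<in> {1..?k}" using rank_range[of "\<tau> ! ?t" \<tau>] t by simp
    have ys: "drop ?t ?rs = ?x # ?ys" using t Cons_nth_drop_Suc[of ?t ?rs] by simp
    have inv: "forward_inv \<tau> ?t s'" using I by simp
    have ck: "fst s' rC = code ?k ?d" using inv by (simp add: forward_inv_def)
    have vd: "\<forall>m \<in> {1..?k}. ?d m \<le> m" using inv unfolding forward_inv_def by fastforce
    \<comment> \<open>Deciding on the element at index \<open>t\<close> requires the optimum for the
      \<open>n - t - 1\<close> elements after it.\<close>
    have tab: "snd s aTab (?o + code ?k d) = best ?ys d" if "\<forall>m \<in> {1..?k}. d m \<le> m" for d
      using T[rule_format, of "?n - Suc ?t" d] that k t by simp
    let ?s1 = "run (SetReg rX (Arr aRank (Reg rT)) ;; SetReg rO (Sub (Reg rO) (Reg rN))) s'"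
    have "(?n - ?t) * ?N - ?N = ?o" using t by (simp add: diff_mult_distrib)
    then have s1: "fst ?s1 rX = ?x" "fst ?s1 rO = ?o" "fst ?s1 rK = ?k" "fst ?s1 rC = fst s' rC"
      "fst ?s1 rT = ?t" "fst ?s1 rM = fst s' rM" "snd ?s1 = snd s'"
      using f t R I by auto
    show "terminates forward_body (150 * (?k + 1) + 40) (\<lambda>s''. ?I s'' \<and> ?\<mu> s'' < ?\<mu> s') s'"
      unfolding forward_body_def
    proof (rule terminates_Seq_loop_free[where b' = "150 * (?k + 1) + 30"])
      show "terminates (new_code ;;
       IfLess (Const 0) (Arr aDig (Reg rX))
         (IfLess (Arr aTab (Add (Reg rO) (Reg rC))) (Add (Arr aTab (Add (Reg rO) (Reg rC'))) (Const 1))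
           take_element Skip)
         Skip ;;
       incr rT (Const 1)) (150 * (?k + 1) + 30) (\<lambda>s''. ?I s'' \<and> ?\<mu> s'' < ?\<mu> s') ?s1"
      proof (rule terminates_Seq[OF new_code_correct, where b\<^sub>2 = "110 * (?k + 1) + 30"])
        show "\<forall>m \<le> fst ?s1 rK + 1. snd ?s1 aFact m = fact m" using W s1 f k by (simp del: run.simps)
        show "fst ?s1 rC = code (fst ?s1 rK) (snd ?s1 aDig)" using s1 ck by (simp del: run.simps)
        show "40 * (fst ?s1 rK + 1) + (110 * (?k + 1) + 30) \<le> 150 * (?k + 1) + 30" using s1 by (simp del: run.simps)
        fix s2 assume c': "0 < snd ?s1 aDig (fst ?s1 rX) \<longrightarrow>
            fst s2 rC' = code (fst ?s1 rK) (upd (fst ?s1 rX) (snd ?s1 aDig))"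
          and fr2: "frame new_code ?s1 s2"
        have s2: "fst s2 rX = ?x" "fst s2 rO = ?o" "fst s2 rK = ?k" "fst s2 rC = fst s' rC"
          "fst s2 rT = ?t" "fst s2 rM = fst s' rM" "snd s2 = snd s'"
          using frame_reg[OF fr2] frame_arr[OF fr2] s1
          by (auto simp: new_code_def new_code_body_def simp del: run.simps)
        have c2: "fst s2 rC' = code ?k (upd ?x ?d)" if "0 < ?d ?x" using c' s1 that by (simp del: run.simps)
        have inv2: "forward_inv \<tau> ?t s2" using inv s2 by (simp add: forward_inv_def)
        have t1: "snd s aTab (?o + fst s' rC) = best ?ys ?d" using tab[OF vd] ck by simp
        have t2: "snd s aTab (?o + fst s2 rC') = best ?ys (upd ?x ?d)" if "0 < ?d ?x"
          using tab[OF upd_valid[OF vd]] c2[OF that] by simp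
        let ?Q = "\<lambda>s3. forward_inv \<tau> (Suc ?t) s3 \<and> fst s3 rT = ?t \<and> fst s3 rO = ?o"
        have skip: "?Q s2" if "best ?ys ?d = best (drop ?t ?rs) ?d"
          using forward_inv_skip[OF inv2] that s2 by simp
        show "terminates (IfLess (Const 0) (Arr aDig (Reg rX))
           (IfLess (Arr aTab (Add (Reg rO) (Reg rC))) (Add (Arr aTab (Add (Reg rO) (Reg rC'))) (Const 1))
             take_element Skip)
           Skip ;;
           incr rT (Const 1)) (110 * (?k + 1) + 30) (\<lambda>s''. ?I s'' \<and> ?\<mu> s'' < ?\<mu> s') s2"
        proof (rule terminates_Seq[where Q = ?Q and b\<^sub>1 = "110 * (?k + 1) + 20" and b\<^sub>2 = 10])
          show "terminates (IfLess (Const 0) (Arr aDig (Reg rX))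
           (IfLess (Arr aTab (Add (Reg rO) (Reg rC))) (Add (Arr aTab (Add (Reg rO) (Reg rC'))) (Const 1))
             take_element Skip)
           Skip) (110 * (?k + 1) + 20) ?Q s2"
          proof (rule terminates_If[where b = "110 * (?k + 1) + 14"])
            assume "aval (Const 0) s2 < aval (Arr aDig (Reg rX)) s2"
            then have pos: "0 < ?d ?x" using s2 by simp
            show "terminates (IfLess (Arr aTab (Add (Reg rO) (Reg rC))) (Add (Arr aTab (Add (Reg rO) (Reg rC'))) (Const 1))
             take_element Skip) (110 * (?k + 1) + 14) ?Q s2"
            proof (rule terminates_If[where b = "110 * (?k + 1)"])
              assume "aval (Arr aTab (Add (Reg rO) (Reg rC))) s2 < aval (Add (Arr aTab (Add (Reg rO) (Reg rC'))) (Const 1)) s2"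
              then have lt: "best ?ys ?d < Suc (best ?ys (upd ?x ?d))" using t1 t2[OF pos] s2 f by simp
              have "terminates take_element (110 * (?k + 1)) (forward_inv \<tau> (Suc ?t)) s2"
                by (rule take_element_correct[OF inv2]) (use t s2 pos c2 inp f ys lt in auto)
              from terminates_frame[OF this] show "terminates take_element (110 * (?k + 1)) ?Q s2"
                by (rule terminates_mono) (use s2 in \<open>auto simp: frame_def take_element_def update_digits_def
                    update_digits_body_def find_slot_def place_def\<close>)
            next
              assume "\<not> aval (Arr aTab (Add (Reg rO) (Reg rC))) s2 < aval (Add (Arr aTab (Add (Reg rO) (Reg rC'))) (Const 1)) s2"
              then have "\<not> best ?ys ?d < Suc (best ?ys (upd ?x ?d))" using t1 t2[OF pos] s2 f by simp
              then have "?Q s2" using ys by (intro skip) simp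
              then show "terminates Skip (110 * (?k + 1)) ?Q s2" by (intro terminates_loop_free) auto
            qed simp
          next
            assume "\<not> aval (Const 0) s2 < aval (Arr aDig (Reg rX)) s2"
            then have "?Q s2" using s2 ys by (intro skip) simp
            then show "terminates Skip (110 * (?k + 1) + 14) ?Q s2" by (intro terminates_loop_free) auto
          qed simp
        next
          fix s3 assume "?Q s3"
          then show "terminates (incr rT (Const 1)) 10 (\<lambda>s''. ?I s'' \<and> ?\<mu> s'' < ?\<mu> s') s3"
            by (intro terminates_loop_free) (use t in \<open>auto simp: forward_inv_def\<close>)
        qed simp
      qed
    qed auto
  next
    fix s' assume I: "?I s'" and fr: "frame forward_body (run ?c0 s) s'"
    assume "\<not> aval (Reg rT) s' < aval (Reg rLen) s'"
    moreover have "fst s' rLen = ?n" using frame_reg[OF fr] n by (auto simp: written_forward_body)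
    ultimately have "fst s' rT = ?n" using I by simp
    then show "forward_inv \<tau> ?n s'" using I by simp
  qed (auto simp: algebra_simps)
qed

section \<open>The complete program and its running time\<close>

definition longest_heapable_program :: com where
  "longest_heapable_program = collect ;; ranks ;; factorials ;; table ;; init_digits 1 (Arr aFact (Reg rI)) ;; forward ;;
     SetReg rLen (Reg rM)"

lemma written_phases:
  "written_regs collect = {rT, rK}" "written_arrs collect = {aIn, aVal, aSeen}"
  "written_regs ranks = {rX, rI, rT}" "written_arrs ranks = {aRank}"
  "written_regs factorials = {rC, rJ, rI, rN}" "written_arrs factorials = {aFact}"
  "written_regs table = {rO, rT, rX, rC, rI, rC'}" "written_arrs table = {aDig, aTab}"
  "written_regs (init_digits v e) = {rC, rI}" "written_arrs (init_digits v e) = {aDig}"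
  by (auto simp: collect_def collect_body_def ranks_def ranks_body_def rank_of_def ranks_inner_def
      factorials_def factorials_body_def next_factorial_def factorials_inner_def table_def table_body_def
      row_def row_body_def new_code_def new_code_body_def odometer_def odometer_body_def
      init_digits_def init_digits_body_def)

text \<open>The digits are set to 1 before the forward pass since the root position is open to every
  rank. Register 0 keeps the input length until the very end because the loops over the input test
  against it.\<close>

lemma longest_heapable_program_correct:
  fixes \<tau> :: "nat list"
  defines "n \<equiv> length \<tau>" and "k \<equiv> card (set \<tau>)"
  shows "terminates longest_heapable_program (50 * (n + 1) + (60 * (n + 1) * (k + 1) + (100 * ((k + 3) * (k + 3)) +
      (400 * (n + 1) * (k + 1) * fact (k + 1) + (40 * (k + 1) + (300 * (n + 1) * (k + 1) + 5))))))
    (\<lambda>s. \<exists>vs ps N. assigns \<tau> vs ps N \<and> length vs = best (map (rank \<tau>) \<tau>) (\<lambda>_. 1) \<and>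
       output_list 0 s = map (vval \<tau>) vs \<and> output_list 1 s = vs \<and> output_list 2 s = ps) (input_state \<tau>)"
  unfolding longest_heapable_program_def
proof (rule terminates_Seq[OF collect_correct[where \<tau> = \<tau>]])
  let ?Q = "\<lambda>s. \<exists>vs ps N. assigns \<tau> vs ps N \<and> length vs = best (map (rank \<tau>) \<tau>) (\<lambda>_. 1) \<and>
       output_list 0 s = map (vval \<tau>) vs \<and> output_list 1 s = vs \<and> output_list 2 s = ps"
  let ?s0 = "input_state \<tau>"
  have s0: "fst ?s0 rLen = n" "snd ?s0 a = (\<lambda>_. 0)" if "a \<noteq> aXs" for a
    using that by (auto simp: input_state_def n_def)
  show "fst ?s0 rLen = length \<tau>" "\<forall>i < length \<tau>. snd ?s0 aXs i = \<tau> ! i" "snd ?s0 aSeen = (\<lambda>_. 0)"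
    by (auto simp: input_state_def)
  fix s1 assume p1: "(\<forall>i < length \<tau>. snd s1 aIn i = \<tau> ! i) \<and> fst s1 rK = card (set \<tau>) \<and>
      distinct (map (snd s1 aVal) [0..<card (set \<tau>)]) \<and> set (map (snd s1 aVal) [0..<card (set \<tau>)]) = set \<tau>"
    and fr1: "frame collect ?s0 s1"
  have s1: "fst s1 rLen = n" "fst s1 rK = k" "snd s1 a = (\<lambda>_. 0)" if "a \<in> {aTab, aHead, aNext, aPar}" for a
    using frame_reg[OF fr1, of rLen] frame_arr[OF fr1, of a] s0[of a] p1 that by (auto simp: written_phases k_def)
  show "terminates (ranks ;; factorials ;; table ;; init_digits 1 (Arr aFact (Reg rI)) ;; forward ;; SetReg rLen (Reg rM))
    (60 * (n + 1) * (k + 1) + (100 * ((k + 3) * (k + 3)) +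
      (400 * (n + 1) * (k + 1) * fact (k + 1) + (40 * (k + 1) + (300 * (n + 1) * (k + 1) + 5))))) ?Q s1"
  proof (rule terminates_Seq[OF ranks_correct[where \<tau> = \<tau>]])
    show "fst s1 rLen = length \<tau>" using s1 n_def by auto
    fix s2 assume p2: "\<forall>i < length \<tau>. snd s2 aRank i = rank \<tau> (\<tau> ! i)" and fr2: "frame ranks s1 s2"
    have s2: "fst s2 rLen = n" "fst s2 rK = k" "snd s2 aIn = snd s1 aIn"
      "snd s2 a = (\<lambda>_. 0)" if "a \<in> {aTab, aHead, aNext, aPar}" for a
      using frame_reg[OF fr2] frame_arr[OF fr2] s1[of a] that by (auto simp: written_phases)
    show "terminates (factorials ;; table ;; init_digits 1 (Arr aFact (Reg rI)) ;; forward ;; SetReg rLen (Reg rM))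
      (100 * ((k + 3) * (k + 3)) +
        (400 * (n + 1) * (k + 1) * fact (k + 1) + (40 * (k + 1) + (300 * (n + 1) * (k + 1) + 5)))) ?Q s2"
    proof (rule terminates_Seq[OF factorials_correct])
      show "100 * ((fst s2 rK + 3) * (fst s2 rK + 3)) +
        (400 * (n + 1) * (k + 1) * fact (k + 1) + (40 * (k + 1) + (300 * (n + 1) * (k + 1) + 5))) \<le>
        100 * ((k + 3) * (k + 3)) +
        (400 * (n + 1) * (k + 1) * fact (k + 1) + (40 * (k + 1) + (300 * (n + 1) * (k + 1) + 5)))"
        using s2(2)[of aTab] by simp
      fix s3 assume p3: "(\<forall>m \<le> fst s2 rK + 1. snd s3 aFact m = fact m) \<and> fst s3 rN = fact (fst s2 rK + 1)"
        and fr3: "frame factorials s2 s3"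
      have s3: "fst s3 rLen = n" "fst s3 rK = k" "snd s3 aIn = snd s1 aIn" "snd s3 aRank = snd s2 aRank"
        "snd s3 a = (\<lambda>_. 0)" if "a \<in> {aTab, aHead, aNext, aPar}" for a
        using frame_reg[OF fr3] frame_arr[OF fr3] s2[of a] that by (auto simp: written_phases)
      note r3 = s3(1-4)[of aTab, simplified]
      have F: "\<forall>m \<le> k + 1. snd s3 aFact m = fact m" "fst s3 rN = fact (k + 1)"
        using p3 s2(2)[of aTab] by auto
      show "terminates (table ;; init_digits 1 (Arr aFact (Reg rI)) ;; forward ;; SetReg rLen (Reg rM))
        (400 * (n + 1) * (k + 1) * fact (k + 1) + (40 * (k + 1) + (300 * (n + 1) * (k + 1) + 5))) ?Q s3"
      proof (rule terminates_Seq[OF table_correct[where xs = "map (rank \<tau>) \<tau>"]])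
        show "\<forall>m \<le> fst s3 rK + 1. snd s3 aFact m = fact m" "fst s3 rN = fact (fst s3 rK + 1)" using F r3 by auto
        show "fst s3 rLen = length (map (rank \<tau>) \<tau>)" using r3 n_def by simp
        show "\<forall>i < length (map (rank \<tau>) \<tau>). snd s3 aRank i = map (rank \<tau>) \<tau> ! i" using r3 p2 by simp
        show "set (map (rank \<tau>) \<tau>) \<subseteq> {1..fst s3 rK}" using r3 rank_range k_def by fastforce
        show "snd s3 aTab = (\<lambda>_. 0)" using s3 by simp
        show "400 * (length (map (rank \<tau>) \<tau>) + 1) * (fst s3 rK + 1) * fact (fst s3 rK + 1) +
          (40 * (k + 1) + (300 * (n + 1) * (k + 1) + 5)) \<le>
          400 * (n + 1) * (k + 1) * fact (k + 1) + (40 * (k + 1) + (300 * (n + 1) * (k + 1) + 5))"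
          using r3 by (simp only: n_def length_map)
        fix s4 assume p4: "fst s4 rO = length (map (rank \<tau>) \<tau>) * fst s3 rN \<and>
            (\<forall>u \<le> length (map (rank \<tau>) \<tau>). \<forall>d. (\<forall>m \<in> {1..fst s3 rK}. d m \<le> m) \<longrightarrow>
              snd s4 aTab (u * fst s3 rN + code (fst s3 rK) d) =
              best (drop (length (map (rank \<tau>) \<tau>) - u) (map (rank \<tau>) \<tau>)) d)"
          and fr4: "frame table s3 s4"
        have s4: "fst s4 rLen = n" "fst s4 rK = k" "fst s4 rN = fst s3 rN" "snd s4 aIn = snd s1 aIn"
          "snd s4 aRank = snd s2 aRank" "snd s4 aFact = snd s3 aFact"
          "snd s4 a = (\<lambda>_. 0)" if "a \<in> {aHead, aNext, aPar}" for a
          using frame_reg[OF fr4] frame_arr[OF fr4] s3[of a] that by (auto simp: written_phases)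
        note r4 = s4(1-6)[of aHead, simplified]
        show "terminates (init_digits 1 (Arr aFact (Reg rI)) ;; forward ;; SetReg rLen (Reg rM))
          (40 * (k + 1) + (300 * (n + 1) * (k + 1) + 5)) ?Q s4"
        proof (rule terminates_Seq[OF init_digits_correct])
          show "\<forall>m \<le> fst s4 rK + 1. snd s4 aFact m = fact m" using F r4 by auto
          show "40 * (fst s4 rK + 1) + (300 * (n + 1) * (k + 1) + 5) \<le> 40 * (k + 1) + (300 * (n + 1) * (k + 1) + 5)"
            using r4 by simp
          fix s5 assume p5: "(\<forall>m \<in> {1..fst s4 rK}. snd s5 aDig m = 1) \<and> snd s5 aDig (fst s4 rK + 1) = 0 \<and>
              fst s5 rC = code (fst s4 rK) (\<lambda>_. 1)"
            and fr5: "frame (init_digits 1 (Arr aFact (Reg rI))) s4 s5"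
          have s5: "fst s5 rLen = n" "fst s5 rK = k" "fst s5 rN = fst s3 rN" "snd s5 aIn = snd s1 aIn"
            "snd s5 aRank = snd s2 aRank" "snd s5 aFact = snd s3 aFact" "fst s5 rO = fst s4 rO"
            "snd s5 aTab = snd s4 aTab" "snd s5 a = (\<lambda>_. 0)" if "a \<in> {aHead, aNext, aPar}" for a
            using frame_reg[OF fr5] frame_arr[OF fr5] s4[of a] that by (auto simp: written_phases)
          note r5 = s5(1-8)[of aHead, simplified]
          show "terminates (forward ;; SetReg rLen (Reg rM)) (300 * (n + 1) * (k + 1) + 5) ?Q s5"
          proof (rule terminates_Seq[OF forward_correct[where \<tau> = \<tau>]])
            show "\<forall>m \<le> fst s5 rK + 1. snd s5 aFact m = fact m" "fst s5 rN = fact (fst s5 rK + 1)"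
              using F r5 by auto
            show "fst s5 rK = card (set \<tau>)" "fst s5 rLen = length \<tau>" using r5 n_def k_def by auto
            show "\<forall>i < length \<tau>. snd s5 aIn i = \<tau> ! i" "\<forall>i < length \<tau>. snd s5 aRank i = rank \<tau> (\<tau> ! i)"
              using r5 p1 p2 by auto
            show "\<forall>u \<le> length \<tau>. \<forall>d. (\<forall>m \<in> {1..fst s5 rK}. d m \<le> m) \<longrightarrow>
              snd s5 aTab (u * fst s5 rN + code (fst s5 rK) d) = best (drop (length \<tau> - u) (map (rank \<tau>) \<tau>)) d"
              using p4 r5 r3 by simp
            show "fst s5 rO = length \<tau> * fst s5 rN" using p4 r5 by simp
            show "fst s5 rC = code (fst s5 rK) (snd s5 aDig)" using p5 r4 r5 by (auto intro: code_cong)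
            show "\<forall>m \<in> {1..fst s5 rK}. snd s5 aDig m = 1" using p5 r4 r5 by simp
            show "snd s5 aHead = (\<lambda>_. 0)" "snd s5 aNext = (\<lambda>_. 0)" "snd s5 aPar = (\<lambda>_. 0)" using s5 by auto
            show "300 * (length \<tau> + 1) * (card (set \<tau>) + 1) + 5 \<le> 300 * (n + 1) * (k + 1) + 5"
              by (simp add: n_def k_def)
            fix s6 assume "forward_inv \<tau> (length \<tau>) s6"
            then obtain vs ps N where a: "assigns \<tau> vs ps N" "fst s6 rM = length vs"
              "\<forall>i < length vs. snd s6 aXs i = vval \<tau> (vs ! i) \<and> snd s6 aVs i = vs ! i \<and> snd s6 aPs i = ps ! i"
              "length vs = best (map (rank \<tau>) \<tau>) (\<lambda>_. 1)"
              by (auto simp: forward_inv_def)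
            let ?s = "run (SetReg rLen (Reg rM)) s6"
            have "output_list 0 ?s = map (vval \<tau>) vs" "output_list 1 ?s = vs" "output_list 2 ?s = ps"
              using a assigns_basic(1)[OF a(1)] by (auto simp: output_list_def intro!: nth_equalityI)
            then have "?Q ?s" using a by blast
            then show "terminates (SetReg rLen (Reg rM)) 5 ?Q s6" by (intro terminates_loop_free) auto
          qed
        qed simp_all
      qed
    qed
  qed (use p1 s1 in \<open>auto simp: n_def k_def\<close>)
qed (simp add: n_def)

theorem theorem1:
  shows "\<exists>(P :: com) (g :: nat \<Rightarrow> real). g \<in> O(\<lambda>n. real n) \<and>
    (\<forall>\<tau> :: nat list. \<exists>t s xs vs ps.
       exec P (input_state \<tau>) t s \<and>
       xs = output_list 0 s \<and> vs = output_list 1 s \<and> ps = output_list 2 s \<and>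
       longest_heapable_subseq xs \<tau> \<and>
       sorted_wrt (<) vs \<and> set vs \<subseteq> {1..length \<tau>} \<and> xs = map (\<lambda>i. \<tau> ! (i - 1)) vs \<and>
       (\<tau> \<noteq> [] \<longrightarrow>
          maximum_binary_tree (PermDAG \<tau>) (parent_graph vs ps) \<and>
          real t \<le> fact (card (set \<tau>) + 1) * real (card (set \<tau>)) * g (length \<tau>)))"
proof (intro exI[of _ longest_heapable_program] exI[of _ "\<lambda>n. 10000 * real n"] conjI allI)
  show "(\<lambda>n. 10000 * real n) \<in> O(\<lambda>n. real n)" by simp
  fix \<tau> :: "nat list"
  let ?n = "length \<tau>" and ?k = "card (set \<tau>)"
  from longest_heapable_program_correct[of \<tau>] obtain t s vs ps N where ex: "exec longest_heapable_program (input_state \<tau>) t s"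
    and time: "t \<le> 50 * (?n + 1) + (60 * (?n + 1) * (?k + 1) + (100 * ((?k + 3) * (?k + 3)) +
      (400 * (?n + 1) * (?k + 1) * fact (?k + 1) + (40 * (?k + 1) + (300 * (?n + 1) * (?k + 1) + 5)))))"
    and asg: "assigns \<tau> vs ps N" "length vs = best (map (rank \<tau>) \<tau>) (\<lambda>_. 1)"
    and out: "output_list 0 s = map (vval \<tau>) vs" "output_list 1 s = vs" "output_list 2 s = ps"
    unfolding terminates_def by blast
  note b = assigns_basic[OF asg(1)]
  have xs: "map (vval \<tau>) vs = map (\<lambda>i. \<tau> ! (i - 1)) vs" using b(3) by (auto simp: vval_def)
  have bound: "real t \<le> fact (?k + 1) * real ?k * (10000 * real ?n)" if "\<tau> \<noteq> []"
  proof -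
    define P where "P = ?n * ?k"
    define F :: nat where "F = fact (?k + 1)"
    have k1: "1 \<le> ?k" using that by (simp add: Suc_le_eq card_gt_0_iff)
    have kn: "?k \<le> ?n" by (rule card_length)
    have F1: "1 \<le> F" unfolding F_def by (rule fact_ge_1)
    have a: "(?n + 1) * (?k + 1) \<le> 4 * P"
    proof -
      have "(?n + 1) * (?k + 1) \<le> (2 * ?n) * (2 * ?k)" using k1 kn by (intro mult_le_mono) auto
      then show ?thesis by (simp add: P_def)
    qed
    have b: "(?k + 3) * (?k + 3) \<le> 16 * P"
    proof -
      have "(?k + 3) * (?k + 3) \<le> (4 * ?n) * (4 * ?k)" using k1 kn by (intro mult_le_mono) auto
      then show ?thesis by (simp add: P_def)
    qed
    have "?n * 1 \<le> P" "1 * ?k \<le> P" unfolding P_def using k1 kn by (intro mult_le_mono; simp)+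
    then have c: "?n + 1 \<le> 2 * P" "?k + 1 \<le> 2 * P" "1 \<le> P" using k1 kn by auto
    have d: "(?n + 1) * (?k + 1) * F \<le> 4 * (P * F)" using mult_le_mono1[OF a, of F] by simp
    have e: "P \<le> P * F" using F1 by simp
    have "t \<le> 50 * (?n + 1) + (60 * ((?n + 1) * (?k + 1)) + (100 * ((?k + 3) * (?k + 3)) +
      (400 * ((?n + 1) * (?k + 1) * F) + (40 * (?k + 1) + (300 * ((?n + 1) * (?k + 1)) + 5)))))"
      using time by (simp only: F_def mult.assoc)
    \<comment> \<open>Bounding each summand by a multiple of \<open>P\<close> or
      \<open>P * F\<close> rests on \<open>1 \<le> k \<le> n\<close>. The coefficients add up to
      4825, for which 10000 is a round bound.\<close>
    also have "\<dots> \<le> 50 * (2 * P) + (60 * (4 * P) + (100 * (16 * P) +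
      (400 * (4 * (P * F)) + (40 * (2 * P) + (300 * (4 * P) + 5 * P)))))"
      using a b c d by (intro add_mono mult_le_mono2) auto
    also have "\<dots> \<le> 10000 * (P * F)" using e by linarith
    finally have "real t \<le> real (10000 * (P * F))" by (simp only: of_nat_le_iff)
    then show ?thesis by (simp add: P_def F_def mult_ac del: fact_Suc)
  qed
  show "\<exists>t s xs vs ps.
       exec longest_heapable_program (input_state \<tau>) t s \<and>
       xs = output_list 0 s \<and> vs = output_list 1 s \<and> ps = output_list 2 s \<and>
       longest_heapable_subseq xs \<tau> \<and>
       sorted_wrt (<) vs \<and> set vs \<subseteq> {1..length \<tau>} \<and> xs = map (\<lambda>i. \<tau> ! (i - 1)) vs \<and>
       (\<tau> \<noteq> [] \<longrightarrow>
          maximum_binary_tree (PermDAG \<tau>) (parent_graph vs ps) \<and>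
          real t \<le> fact (card (set \<tau>) + 1) * real (card (set \<tau>)) * (10000 * real (length \<tau>)))"
    using ex out xs b(2,3) bound assigns_optimal[OF asg] by metis
qed

end
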